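(* Let $\mathbb{O}$ be an octonion algebra over a field $F$, and let $A$ be a subalgebra of $\mathbb{O}$. If $\dim A>4$ then either $A=\mathbb{O}$, or $\mathbb{O}$ is split and one of the following cases occurs: (a) $\dim A=5$, and there exists a nilpotent element $n$ such that $A=n\mathbb{O}+\mathbb{O}n$. These subalgebras form a single orbit under $\mathrm{Aut}_F(\mathbb{O})$. (b) $\dim A=6$, and there exist two linearly independent nilpotent elements $m,n$ with $mn=0$ such that $A=\{m,n\}^\perp$. Then $A=m\mathbb{O}+n\mathbb{O}=\mathbb{O}m+\mathbb{O}n$. These subalgebras form a single orbit under $\mathrm{Aut}_F(\mathbb{O})$.
   Context: $F$ is an arbitrary field (any characteristic). A composition algebra over $F$ is a (not necessarily associative) $F$-algebra $C$ with neutral element $1$ and a quadratic form $N\colon C\to F$ (norm) with $N(xy)=N(x)N(y)$ whose polar form $(x|y)=N(x+y)-N(x)-N(y)$ is non-degenerate. An octonion algebra is a composition algebra of dimension $8$; it is split if some non-zero element has norm $0$. Orthogonality $\perp$ refers to the polar form. A nilpotent element is an element $n$ with $n^2=0$ (equivalently, norm $0$ and trace $(n|1)=0$). A subalgebra is an $F$-linear subspace closed under multiplication (it need not contain $1$). $\mathrm{Aut}_F(\mathbb{O})$ is the group of $F$-linear algebra automorphisms. For $a\in\mathbb{O}$: $a\mathbb{O}=\{ax\mid x\in\mathbb{O}\}$, $\mathbb{O}a=\{xa\mid x\in\mathbb{O}\}$. *)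

theory Defs
  imports Complex_Main "HOL-Library.Set_Algebras"
begin

definition polar :: "('a::ab_group_add \<Rightarrow> 'f::field) \<Rightarrow> 'a \<Rightarrow> 'a \<Rightarrow> 'f" where
  "polar N x y = N (x + y) - N x - N y"

definition quadratic_form ::
    "('f::field \<Rightarrow> 'a::ab_group_add \<Rightarrow> 'a) \<Rightarrow> ('a \<Rightarrow> 'f) \<Rightarrow> bool" where
  "quadratic_form scale N \<longleftrightarrow>
     (\<forall>c x. N (scale c x) = c\<^sup>2 * N x) \<and>
     (\<forall>y. Vector_Spaces.linear scale (*) (\<lambda>x. polar N x y)) \<and>
     (\<forall>x. Vector_Spaces.linear scale (*) (\<lambda>y. polar N x y))"

definition nondegenerate :: "('a::ab_group_add \<Rightarrow> 'a \<Rightarrow> 'f::field) \<Rightarrow> bool" where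
  "nondegenerate B \<longleftrightarrow> (\<forall>x. (\<forall>y. B x y = 0) \<longrightarrow> x = 0)"

locale composition_algebra = vector_space scale
  for scale :: "'f::field \<Rightarrow> 'a::ab_group_add \<Rightarrow> 'a" +
  fixes mult :: "'a \<Rightarrow> 'a \<Rightarrow> 'a" (infixl "\<cdot>" 70)
    and unit :: 'a
    and N :: "'a \<Rightarrow> 'f"
  assumes mult_linear_left: "Vector_Spaces.linear scale scale (\<lambda>x. x \<cdot> y)"
    and mult_linear_right: "Vector_Spaces.linear scale scale (\<lambda>y. x \<cdot> y)"
    and unit_left: "unit \<cdot> x = x"
    and unit_right: "x \<cdot> unit = x"
    and norm_quadratic: "quadratic_form scale N"
    and norm_mult: "N (x \<cdot> y) = N x * N y"
    and polar_nondegenerate: "nondegenerate (polar N)"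

locale octonion_algebra = composition_algebra +
  assumes dim_eq_8: "dim UNIV = 8"

definition split_norm :: "('a::ab_group_add \<Rightarrow> 'f::field) \<Rightarrow> bool" where
  "split_norm N \<longleftrightarrow> (\<exists>x. x \<noteq> 0 \<and> N x = 0)"

definition subalgebra ::
    "('f::field \<Rightarrow> 'a::ab_group_add \<Rightarrow> 'a) \<Rightarrow> ('a \<Rightarrow> 'a \<Rightarrow> 'a) \<Rightarrow> 'a set \<Rightarrow> bool" where
  "subalgebra scale mult A \<longleftrightarrow>
     module.subspace scale A \<and> (\<forall>x\<in>A. \<forall>y\<in>A. mult x y \<in> A)"

definition nilpotent :: "('a::ab_group_add \<Rightarrow> 'a \<Rightarrow> 'a) \<Rightarrow> 'a \<Rightarrow> bool" where
  "nilpotent mult n \<longleftrightarrow> mult n n = 0"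

definition orthogonal_complement ::
    "('a::ab_group_add \<Rightarrow> 'f::field) \<Rightarrow> 'a set \<Rightarrow> 'a set" where
  "orthogonal_complement N S = {x. \<forall>s\<in>S. polar N x s = 0}"

definition left_translates :: "('a \<Rightarrow> 'a \<Rightarrow> 'a) \<Rightarrow> 'a \<Rightarrow> 'a set" where
  "left_translates mult a = {mult a x | x. True}"

definition right_translates :: "('a \<Rightarrow> 'a \<Rightarrow> 'a) \<Rightarrow> 'a \<Rightarrow> 'a set" where
  "right_translates mult a = {mult x a | x. True}"

definition automorphisms ::
    "('f::field \<Rightarrow> 'a::ab_group_add \<Rightarrow> 'a) \<Rightarrow> ('a \<Rightarrow> 'a \<Rightarrow> 'a) \<Rightarrow> ('a \<Rightarrow> 'a) set" where
  "automorphisms scale mult =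
     {f. bij f \<and> Vector_Spaces.linear scale scale f \<and> (\<forall>x y. f (mult x y) = mult (f x) (f y))}"

text \<open>An orbit is in particular a non-empty family.\<close>

definition single_orbit ::
    "('f::field \<Rightarrow> 'a::ab_group_add \<Rightarrow> 'a) \<Rightarrow> ('a \<Rightarrow> 'a \<Rightarrow> 'a) \<Rightarrow> 'a set set \<Rightarrow> bool" where
  "single_orbit scale mult S \<longleftrightarrow>
     (\<exists>A. S = {f ` A | f. f \<in> automorphisms scale mult})"

text \<open>Distinctness has to be required separately for the pair to be linearly independent:
  \<open>{m, n}\<close> collapses to a singleton when \<open>m = n\<close>.\<close>

definition annihilating_nilpotent_pair ::
    "('f::field \<Rightarrow> 'a::ab_group_add \<Rightarrow> 'a) \<Rightarrow> ('a \<Rightarrow> 'a \<Rightarrow> 'a) \<Rightarrow> 'a \<Rightarrow> 'a \<Rightarrow> bool" where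
  "annihilating_nilpotent_pair scale mult m n \<longleftrightarrow>
     nilpotent mult m \<and> nilpotent mult n \<and>
     m \<noteq> n \<and> \<not> module.dependent scale {m, n} \<and> mult m n = 0"

text \<open>Here \<open>+\<close> is the elementwise sum of sets from Set_Algebras.\<close>

definition type_a ::
    "('f::field \<Rightarrow> 'a::ab_group_add \<Rightarrow> 'a) \<Rightarrow> ('a \<Rightarrow> 'a \<Rightarrow> 'a) \<Rightarrow> 'a set \<Rightarrow> bool" where
  "type_a scale mult A \<longleftrightarrow>
     vector_space.dim scale A = 5 \<and>
     (\<exists>n. nilpotent mult n \<and> A = left_translates mult n + right_translates mult n)"

definition type_b ::
    "('f::field \<Rightarrow> 'a::ab_group_add \<Rightarrow> 'a) \<Rightarrow> ('a \<Rightarrow> 'a \<Rightarrow> 'a) \<Rightarrow> ('a \<Rightarrow> 'f) \<Rightarrow> 'a set \<Rightarrow> bool"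
where
  "type_b scale mult N A \<longleftrightarrow>
     vector_space.dim scale A = 6 \<and>
     (\<exists>m n. annihilating_nilpotent_pair scale mult m n \<and> A = orthogonal_complement N {m, n})"

end

(*
  A subalgebra A of dimension > 4 is not totally singular, so it contains an invertible a,
  and aA = A gives 1 in A. If A is proper, then W = A^perp is a totally singular ideal of A of
  dimension at most 3, consisting of nilpotents. Dimension 1 is impossible. In dimension 2 the
  product on W vanishes, which is case (b). In dimension 3 the product on W does not vanish, W is
  spanned by p, q, pq, and A = nO + On for n = pq, which is case (a).

  Transitivity comes from frames: an idempotent e of trace 1 and a basis v1, v2, v3 of
  {v. ev = v, ve = 0} of volume (v1|v2 v3) = -1. With f = 1 - e and w1 = v2 v3, w2 = v3 v1,
  w3 = v1 v2, the eight elements e, f, vi, wi form a basis with a fixed multiplication table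
  (Zorn's vector matrices). Every non-zero nilpotent is the v1 of a frame, and every pair of
  independent nilpotents with product 0 is the pair (v1, w2) of a frame.
*)

theory Submission imports Defs begin

section \<open>Composition algebras\<close>

context composition_algebra
begin

abbreviation pol :: "'a \<Rightarrow> 'a \<Rightarrow> 'f" where "pol \<equiv> polar N"

lemma module_hom_mult_left: "module_hom scale scale (\<lambda>x. x \<cdot> z)"
  and module_hom_mult_right: "module_hom scale scale (\<lambda>x. z \<cdot> x)"
  using mult_linear_left[of z] mult_linear_right[of z] by (simp_all only: module_hom_eq_linear)

lemma mult_add_left: "(x + y) \<cdot> z = x \<cdot> z + y \<cdot> z"
  and mult_scale_left: "scale c x \<cdot> z = scale c (x \<cdot> z)"
  and mult_minus_left: "(- x) \<cdot> z = - (x \<cdot> z)"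
  and mult_diff_left: "(x - y) \<cdot> z = x \<cdot> z - y \<cdot> z"
  and mult_zero_left: "0 \<cdot> z = 0"
  by (simp_all add: module_hom.add[OF module_hom_mult_left] module_hom.scale[OF module_hom_mult_left]
      module_hom.neg[OF module_hom_mult_left] module_hom.diff[OF module_hom_mult_left] module_hom.zero[OF module_hom_mult_left])

lemma mult_add_right: "z \<cdot> (x + y) = z \<cdot> x + z \<cdot> y"
  and mult_scale_right: "z \<cdot> scale c x = scale c (z \<cdot> x)"
  and mult_minus_right: "z \<cdot> (- x) = - (z \<cdot> x)"
  and mult_diff_right: "z \<cdot> (x - y) = z \<cdot> x - z \<cdot> y"
  and mult_zero_right: "z \<cdot> 0 = 0"
  by (simp_all add: module_hom.add[OF module_hom_mult_right] module_hom.scale[OF module_hom_mult_right]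
      module_hom.neg[OF module_hom_mult_right] module_hom.diff[OF module_hom_mult_right] module_hom.zero[OF module_hom_mult_right])

lemma pol_linear_left: "module_hom scale (*) (\<lambda>x. pol x y)"
  and pol_linear_right: "module_hom scale (*) (\<lambda>y. pol x y)"
  and norm_scale: "N (scale c x) = c\<^sup>2 * N x"
  using norm_quadratic by (auto simp: quadratic_form_def module_hom_iff_linear)

lemma pol_add_left: "pol (x + y) z = pol x z + pol y z"
  and pol_scale_left: "pol (scale c x) z = c * pol x z"
  and pol_minus_left: "pol (- x) z = - pol x z"
  and pol_diff_left: "pol (x - y) z = pol x z - pol y z"
  and pol_zero_left: "pol 0 z = 0"
  by (simp_all add: module_hom.add[OF pol_linear_left] module_hom.scale[OF pol_linear_left]
      module_hom.neg[OF pol_linear_left] module_hom.diff[OF pol_linear_left] module_hom.zero[OF pol_linear_left])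

lemma pol_add_right: "pol z (x + y) = pol z x + pol z y"
  and pol_scale_right: "pol z (scale c x) = c * pol z x"
  and pol_minus_right: "pol z (- x) = - pol z x"
  and pol_diff_right: "pol z (x - y) = pol z x - pol z y"
  and pol_zero_right: "pol z 0 = 0"
  by (simp_all add: module_hom.add[OF pol_linear_right] module_hom.scale[OF pol_linear_right]
      module_hom.neg[OF pol_linear_right] module_hom.diff[OF pol_linear_right] module_hom.zero[OF pol_linear_right])

lemmas mult_simps = mult_add_left mult_scale_left mult_minus_left mult_diff_left mult_zero_left
  mult_add_right mult_scale_right mult_minus_right mult_diff_right mult_zero_right
  unit_left unit_right
lemmas pol_simps = pol_add_left pol_scale_left pol_minus_left pol_diff_left pol_zero_left
  pol_add_right pol_scale_right pol_minus_right pol_diff_right pol_zero_right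

lemma norm_add: "N (x + y) = N x + N y + pol x y"
  by (simp add: polar_def)

lemma norm_zero: "N 0 = 0"
  using norm_scale[of 0 0] by simp

lemma pol_commute: "pol x y = pol y x"
  by (simp add: polar_def add.commute)

text \<open>Non-degeneracy in working form: product identities are proved below by pairing both
  sides with an arbitrary element.\<close>

lemma eqI_pol: "x = y" if "\<And>z. pol x z = pol y z"
proof -
  have "pol (x - y) z = 0" for z
    using that by (simp add: pol_simps)
  then have "x - y = 0"
    using polar_nondegenerate unfolding nondegenerate_def by blast
  then show ?thesis by simp
qed

lemma pol_mult_left: "pol (x \<cdot> y) (x \<cdot> z) = N x * pol y z"
  by (simp add: polar_def norm_mult mult_add_right[symmetric] algebra_simps)

lemma pol_mult_right: "pol (x \<cdot> y) (z \<cdot> y) = pol x z * N y"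
  by (simp add: polar_def norm_mult mult_add_left[symmetric] algebra_simps)

text \<open>Linearization of \<open>pol_mult_left\<close> in its common left factor. Setting one
  factor to \<open>unit\<close> yields both adjoint formulas below.\<close>

lemma pol_mult_exchange: "pol (x \<cdot> y) (w \<cdot> z) + pol (w \<cdot> y) (x \<cdot> z) = pol x w * pol y z"
  using pol_mult_left[of "x + w" y z]
  by (simp add: norm_add mult_simps pol_simps pol_mult_left pol_commute[of w x] algebra_simps)

definition tr :: "'a \<Rightarrow> 'f" where "tr x = pol x unit"

definition cnj :: "'a \<Rightarrow> 'a" where "cnj x = scale (tr x) unit - x"

lemma tr_add: "tr (x + y) = tr x + tr y"
  and tr_scale: "tr (scale c x) = c * tr x"
  and tr_minus: "tr (- x) = - tr x"
  and tr_diff: "tr (x - y) = tr x - tr y"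
  and tr_zero: "tr 0 = 0"
  by (simp_all add: tr_def pol_simps)

lemmas tr_simps = tr_add tr_scale tr_minus tr_diff tr_zero

lemma cnj_trace_zero: "tr x = 0 \<Longrightarrow> cnj x = - x"
  by (simp add: cnj_def)

lemma cnj_mult: "cnj x \<cdot> y = scale (tr x) y - x \<cdot> y"
  and mult_cnj: "y \<cdot> cnj x = scale (tr x) y - y \<cdot> x"
  by (simp_all add: cnj_def mult_simps)

text \<open>The exchange formula with \<open>unit\<close> as the second left factor gives (xy|z) +
  (y|xz) = tr(x) (y|z), and \<open>cnj\<close> absorbs the trace term.\<close>

lemma pol_adjoint_left: "pol (x \<cdot> y) z = pol y (cnj x \<cdot> z)"
  using pol_mult_exchange[of x y unit z]
  by (simp add: cnj_mult mult_simps pol_simps tr_def algebra_simps)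

lemma pol_adjoint_right: "pol (x \<cdot> y) z = pol x (z \<cdot> cnj y)"
  using pol_mult_exchange[of x y z unit]
  by (simp add: mult_cnj mult_simps pol_simps tr_def pol_commute algebra_simps)

text \<open>Adjointness turns the pairing with z into (xz|xy), from which N(x) splits off. This is
  the substitute for associativity: all later rewriting of products comes from it, its mirror image
  and their linearizations.\<close>

lemma cnj_mult_cancel: "cnj x \<cdot> (x \<cdot> y) = scale (N x) y"
proof (rule eqI_pol)
  fix z
  have "pol (cnj x \<cdot> (x \<cdot> y)) z = pol (x \<cdot> z) (x \<cdot> y)"
    by (metis pol_adjoint_left pol_commute)
  then show "pol (cnj x \<cdot> (x \<cdot> y)) z = pol (scale (N x) y) z"
    by (simp add: pol_mult_left pol_simps pol_commute)
qed

lemma mult_cnj_cancel: "(y \<cdot> x) \<cdot> cnj x = scale (N x) y"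
proof (rule eqI_pol)
  fix z
  have "pol ((y \<cdot> x) \<cdot> cnj x) z = pol (z \<cdot> x) (y \<cdot> x)"
    by (metis pol_adjoint_right pol_commute)
  then show "pol ((y \<cdot> x) \<cdot> cnj x) z = pol (scale (N x) y) z"
    by (simp add: pol_mult_right pol_simps pol_commute)
qed

lemma cnj_add: "cnj (x + y) = cnj x + cnj y"
  by (simp add: cnj_def tr_simps scale_left_distrib)

lemma cnj_exchange_left: "cnj a \<cdot> (b \<cdot> c) + cnj b \<cdot> (a \<cdot> c) = scale (pol a b) c"
proof -
  have "cnj (a + b) \<cdot> ((a + b) \<cdot> c) = scale (N (a + b)) c"
    by (rule cnj_mult_cancel)
  then show ?thesis
    using cnj_mult_cancel[of a c] cnj_mult_cancel[of b c]
    by (simp add: cnj_add mult_simps norm_add scale_left_distrib algebra_simps)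
qed

lemma cnj_exchange_right: "(a \<cdot> b) \<cdot> cnj c + (a \<cdot> c) \<cdot> cnj b = scale (pol b c) a"
proof -
  have "(a \<cdot> (b + c)) \<cdot> cnj (b + c) = scale (N (b + c)) a"
    by (rule mult_cnj_cancel)
  then show ?thesis
    using mult_cnj_cancel[of a b] mult_cnj_cancel[of a c]
    by (simp add: cnj_add mult_simps norm_add scale_left_distrib algebra_simps)
qed

lemma square_eq: "x \<cdot> x = scale (tr x) x - scale (N x) unit"
  using cnj_mult_cancel[of x unit] by (simp add: cnj_mult mult_simps algebra_simps)

text \<open>Alternativity: replace \<open>cnj x\<close> by its definition in
  \<open>cnj_mult_cancel\<close> and compare with the quadratic equation of x.\<close>

lemma mult_mult_left: "x \<cdot> (x \<cdot> y) = (x \<cdot> x) \<cdot> y"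
  using cnj_mult_cancel[of x y]
  by (simp add: cnj_mult square_eq mult_simps algebra_simps)

lemma mult_mult_right: "(y \<cdot> x) \<cdot> x = y \<cdot> (x \<cdot> x)"
  using mult_cnj_cancel[of y x]
  by (simp add: mult_cnj square_eq mult_simps algebra_simps)

lemma mult_add_mult_commute:
  "x \<cdot> y + y \<cdot> x = scale (tr x) y + scale (tr y) x - scale (pol x y) unit"
proof -
  have "(x \<cdot> x + x \<cdot> y) + (y \<cdot> x + y \<cdot> y) = scale (tr (x + y)) (x + y) - scale (N (x + y)) unit"
    using square_eq[of "x + y"] by (simp only: mult_add_left mult_add_right ac_simps)
  then show ?thesis
    by (simp add: square_eq mult_simps tr_simps norm_add scale_left_distrib scale_right_distrib algebra_simps)
qed

lemma tr_mult: "tr (x \<cdot> y) = tr x * tr y - pol x y"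
  using pol_adjoint_left[of x y unit]
  by (simp add: tr_def cnj_def mult_simps pol_simps pol_commute)

text \<open>The anticommutator formula evaluates (xy)x + x(xy) and x(xy + yx) to the same element
  \<open>R\<close>; cancelling x(xy) leaves the claim.\<close>

lemma flexible: "(x \<cdot> y) \<cdot> x = x \<cdot> (y \<cdot> x)"
proof -
  define R where "R = scale (tr x) (x \<cdot> y) + scale (tr (x \<cdot> y)) x - scale (N x * tr y) unit"
  have pol_eq: "pol x (x \<cdot> y) = N x * tr y"
    using pol_mult_left[of x unit y] by (simp add: mult_simps tr_def pol_commute)
  have "(x \<cdot> y) \<cdot> x + x \<cdot> (x \<cdot> y) = R"
    using mult_add_mult_commute[of x "x \<cdot> y"] by (simp add: pol_eq R_def add.commute)
  moreover have "x \<cdot> (x \<cdot> y + y \<cdot> x) = R"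
    by (simp add: mult_add_mult_commute R_def mult_diff_right mult_add_right mult_scale_right
        square_eq unit_right tr_mult scale_right_diff_distrib scale_left_diff_distrib algebra_simps)
  ultimately show ?thesis
    by (simp add: mult_add_right add.commute[of "x \<cdot> (x \<cdot> y)"]) (metis add_right_cancel)
qed

end

section \<open>Orthogonal complements\<close>

context octonion_algebra
begin

text \<open>The finite-dimensional locale takes a basis as a parameter, so one is chosen
  here.\<close>

definition oct_basis :: "'b set" where
  "oct_basis = (SOME B. finite B \<and> independent B \<and> span B = UNIV)"

lemma oct_basis: "finite oct_basis" "independent oct_basis" "span oct_basis = UNIV"
proof -
  obtain B where B: "independent B" "span B = UNIV" "card B = dim UNIV"
    by (metis basis_exists top.extremum_uniqueI)
  \<comment> \<open>An infinite set has \<open>card\<close> 0, so cardinality 8 forces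
    finiteness.\<close>
  then have "finite B"
    using dim_eq_8 card.infinite by fastforce
  with B have "\<exists>B. finite B \<and> independent B \<and> span B = UNIV"
    by blast
  from someI_ex[OF this]
  show "finite oct_basis" "independent oct_basis" "span oct_basis = UNIV"
    by (auto simp: oct_basis_def)
qed

sublocale finite_dimensional_vector_space scale oct_basis
  by unfold_locales (simp_all add: oct_basis)

lemma card_oct_basis: "card oct_basis = 8"
  using dim_eq_8 by simp

text \<open>The functional (-|y) separates a from the span. With dual vectors for y this reads
  linear independence off a table of polar values.\<close>

lemma not_in_span_pol:
  assumes "pol a y \<noteq> 0" and "\<forall>s\<in>S. pol s y = 0"
  shows "a \<notin> span S"
proof
  assume "a \<in> span S"
  then have "pol a y = 0"
    by (induction rule: span_induct_alt) (simp_all add: assms pol_simps)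
  then show False using assms by simp
qed

lemma dim_insert_pol:
  assumes "pol a y \<noteq> 0" and "\<forall>s\<in>S. pol s y = 0"
  shows "dim (insert a S) = Suc (dim S)"
  using not_in_span_pol[OF assms] by (simp add: dim_insert)

abbreviation perp :: "'b set \<Rightarrow> 'b set" where
  "perp \<equiv> orthogonal_complement N"

lemma subspace_perp: "subspace (perp S)"
  by (auto simp: orthogonal_complement_def subspace_def pol_simps)

lemma perp_antimono: "S \<subseteq> T \<Longrightarrow> perp T \<subseteq> perp S"
  by (auto simp: orthogonal_complement_def)

lemma perp_span: "perp (span S) = perp S"
proof
  show "perp (span S) \<subseteq> perp S"
    by (rule perp_antimono) (rule span_superset)
  have "pol x s = 0" if "x \<in> perp S" "s \<in> span S" for x s
    using that(2) that(1)
    by (induction rule: span_induct_alt) (auto simp: orthogonal_complement_def pol_simps)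
  then show "perp S \<subseteq> perp (span S)"
    by (auto simp: orthogonal_complement_def)
qed

lemma dim_image_inj: "Vector_Spaces.linear scale scale h \<Longrightarrow> inj h \<Longrightarrow> dim (h ` S) = dim S"
proof -
  interpret P: finite_dimensional_vector_space_pair scale oct_basis scale oct_basis
    by unfold_locales
  show "Vector_Spaces.linear scale scale h \<Longrightarrow> inj h \<Longrightarrow> dim (h ` S) = dim S"
    using P.dim_image_eq by (meson inj_on_subset subset_UNIV)
qed

text \<open>For a basis \<open>C\<close> the map \<open>x \<mapsto> \<Sum>c\<in>C. (x|c) c\<close> is injective by non-degeneracy,
  hence bijective, and it carries the complement of \<open>B \<subseteq> C\<close> onto the span of \<open>C - B\<close>.\<close>

lemma dim_perp: "dim S + dim (perp S) = 8"
proof -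
  obtain B where B: "B \<subseteq> S" "independent B" "S \<subseteq> span B" "card B = dim S"
    using basis_exists by blast
  have span_B: "span B = span S"
    using B by (simp add: span_eq span_superset subset_trans)
  define C where "C = extend_basis B"
  have C: "B \<subseteq> C" "independent C" "span C = UNIV"
    using B(2) by (auto simp: C_def extend_basis_superset independent_extend_basis span_extend_basis)
  have finC: "finite C" using C(2) by (rule finiteI_independent)
  have card_C: "card C = 8"
    using C dim_eq_8 by (metis dim_span_eq_card_independent)
  define T where "T x = (\<Sum>c\<in>C. scale (pol x c) c)" for x
  have linT: "Vector_Spaces.linear scale scale T"
    unfolding module_hom_iff_linear[symmetric] T_def
    by unfold_locales
      (simp_all add: pol_simps scale_left_distrib sum.distrib scale_sum_right)
  interpret T: Vector_Spaces.linear scale scale T by (rule linT)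
  \<comment> \<open>The coordinates of \<open>T x\<close> in the basis \<open>C\<close> are the
    values (x|c), and coordinates are unique. The choice \<open>D = {}\<close> gives injectivity of
    \<open>T\<close>, the choice \<open>D = C - B\<close> the image of the complement.\<close>
  have coeff: "pol x c = 0" if Tx: "T x \<in> span D" and "D \<subseteq> C" "c \<in> C" "c \<notin> D" for x D c
  proof -
    have finD: "finite D" using that finC finite_subset by blast
    then obtain u where u: "T x = (\<Sum>v\<in>D. scale (u v) v)"
      using Tx by (auto simp: span_finite)
    have "(\<Sum>v\<in>C. scale (pol x v - (if v \<in> D then u v else 0)) v) = 0"
    proof -
      have "(\<Sum>v\<in>C. scale (if v \<in> D then u v else 0) v) = (\<Sum>v\<in>C. if v \<in> D then scale (u v) v else 0)"
        by (rule sum.cong) auto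
      also have "\<dots> = (\<Sum>v\<in>D. scale (u v) v)"
        using that(2) finC by (simp add: sum.If_cases Int_absorb1)
      finally show ?thesis
        using u by (simp add: scale_left_diff_distrib sum_subtractf T_def)
    qed
    then have "pol x c - (if c \<in> D then u c else 0) = 0"
      using C(2)[unfolded independent_explicit, THEN conjunct2, THEN spec,
          of "\<lambda>v. pol x v - (if v \<in> D then u v else 0)"] \<open>c \<in> C\<close> by simp
    then show ?thesis using that by simp
  qed
  have "inj T"
    unfolding T.inj_iff_eq_0
  proof (intro allI impI)
    fix x assume "T x = 0"
    then have "pol x c = 0" if "c \<in> C" for c
      using coeff[of x "{}"] that by (simp)
    then have "x \<in> perp C"
      by (simp add: orthogonal_complement_def)
    then have "x \<in> perp (span C)"
      by (simp only: perp_span)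
    then have "pol x z = pol 0 z" for z
      using C(3) by (simp add: orthogonal_complement_def pol_simps)
    then show "x = 0" by (rule eqI_pol)
  qed
  then have surj: "surj T" using linT by (rule linear_inj_imp_surj[rotated])
  have "T ` perp S = span (C - B)"
  proof
    have "perp S = perp B"
      using span_B by (metis perp_span)
    then have zero: "pol x c = 0" if "x \<in> perp S" "c \<in> B" for x c
      using that by (auto simp: orthogonal_complement_def)
    show "T ` perp S \<subseteq> span (C - B)"
    proof clarify
      fix x assume x: "x \<in> perp S"
      have "T x = (\<Sum>c\<in>C - B. scale (pol x c) c)"
        unfolding T_def using zero[OF x] finC by (intro sum.mono_neutral_right) auto
      then show "T x \<in> span (C - B)"
        by (auto intro!: span_sum intro: span_scale span_base)
    qed
    show "span (C - B) \<subseteq> T ` perp S"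
    proof
      fix y assume y: "y \<in> span (C - B)"
      obtain x where x: "y = T x" using surj by auto
      have "pol x c = 0" if "c \<in> B" for c
        using coeff[of x "C - B" c] y x that C(1) by auto
      then have "x \<in> perp B" by (simp add: orthogonal_complement_def)
      then show "y \<in> T ` perp S"
        using x \<open>perp S = perp B\<close> by simp
    qed
  qed
  moreover have "dim (T ` perp S) = dim (perp S)"
    using dim_image_inj[OF linT \<open>inj T\<close>] .
  moreover have "dim (span (C - B)) = card C - card B"
    using C finC by (metis Diff_subset card_Diff_subset dim_span_eq_card_independent
        finite_subset independent_mono)
  moreover have "card B \<le> card C" using C(1) finC by (rule card_mono[rotated])
  ultimately show ?thesis using B(4) card_C by simp
qed

lemma perp_perp: "perp (perp S) = span S"
proof -
  have "span S \<subseteq> perp (perp S)"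
    by (rule span_minimal[OF _ subspace_perp]) (auto simp: orthogonal_complement_def pol_commute)
  moreover have "dim (perp (perp S)) = dim (span S)"
    using dim_perp[of S] dim_perp[of "perp S"] by simp
  ultimately show ?thesis
    using subspace_dim_equal[of "span S" "perp (perp S)"] by (simp add: subspace_perp)
qed

lemma isotropic_dim_le: "S \<subseteq> perp S \<Longrightarrow> dim S \<le> 4"
  using dim_perp[of S] dim_subset[of S "perp S"] by simp

lemma dim_perp_pos:
  assumes "finite S" "card S < 8"
  obtains c where "c \<in> perp S" "c \<noteq> 0"
proof -
  have "dim S \<le> card S" using assms span_superset by (intro dim_le_card)
  then have "\<not> perp S \<subseteq> {0}" using assms dim_perp[of S] by (auto simp flip: dim_eq_0)
  then show ?thesis using that by blast
qed

section \<open>The norm of the unit; Peirce components of an idempotent\<close>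

lemma norm_unit: "N unit = 1"
proof (rule ccontr)
  assume "N unit \<noteq> 1"
  \<comment> \<open>\<open>N unit\<close> is an idempotent scalar, so 0 or 1. The value 0 would make
    the norm, hence the polar form, vanish identically.\<close>
  moreover have "N unit * N unit = N unit * 1"
    using norm_mult[of unit unit] by (simp add: unit_left)
  ultimately have "N unit = 0" by (metis mult_cancel_left)
  then have zero: "N x = 0" for x
    using norm_mult[of x unit] by (simp add: unit_right)
  have "x = 0" for x :: 'b
    by (rule eqI_pol) (simp add: polar_def zero)
  then have "UNIV \<subseteq> {0 :: 'b}" by blast
  then have "dim UNIV = 0" using dim_eq_0 by blast
  then show False using dim_eq_8 by simp
qed

lemma pol_self: "pol x x = 2 * N x"
  using norm_scale[of 2 x] scale_left_distrib[of 1 1 x] by (simp add: polar_def)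

lemma tr_unit: "tr unit = 2"
  by (simp add: tr_def pol_self norm_unit)

text \<open>By the quadratic equation these are exactly the idempotents other than 0 and
  \<open>unit\<close>.\<close>

definition idem :: "'b \<Rightarrow> bool" where
  "idem x \<longleftrightarrow> N x = 0 \<and> tr x = 1"

text \<open>An off-diagonal Peirce component of x. The opposite one is the component of
  \<open>unit - x\<close>, so each lemma proved for an idempotent serves both.\<close>

definition peirce :: "'b \<Rightarrow> 'b set" where
  "peirce x = {v. x \<cdot> v = v \<and> v \<cdot> x = 0}"

lemma idem_mult: "idem x \<Longrightarrow> x \<cdot> x = x"
  by (simp add: square_eq idem_def)

lemma idem_compl: "idem x \<Longrightarrow> idem (unit - x)"
  using norm_add[of "unit - x" x]
  by (simp add: idem_def norm_unit tr_diff tr_unit pol_simps pol_self pol_commute[of unit] flip: tr_def)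

lemma peirce_compl: "u \<in> peirce (unit - x) \<longleftrightarrow> x \<cdot> u = 0 \<and> u \<cdot> x = u"
  by (auto simp: peirce_def mult_simps)

context
  fixes x assumes x: "idem x"
begin

text \<open>Since v = xv, the factor N(x) = 0 comes out of the norm, and likewise out of the polar
  form below.\<close>

lemma peirce_norm: "v \<in> peirce x \<Longrightarrow> N v = 0"
  using norm_mult[of x v] x by (simp add: peirce_def idem_def)

lemma peirce_pol: "v \<in> peirce x \<Longrightarrow> v' \<in> peirce x \<Longrightarrow> pol v v' = 0"
  using pol_mult_left[of x v v'] x by (simp add: peirce_def idem_def)

text \<open>\<open>tr_mult\<close> is symmetric in its factors, so tr(v) = tr(xv) = tr(vx) =
  0.\<close>

lemma peirce_tr: "v \<in> peirce x \<Longrightarrow> tr v = 0"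
  using tr_mult[of x v] tr_mult[of v x]
  by (simp add: peirce_def tr_zero pol_commute mult.commute)

lemma peirce_pol_idem: "v \<in> peirce x \<Longrightarrow> pol x v = 0"
  using tr_mult[of v x] peirce_tr[of v]
  by (simp add: peirce_def tr_zero pol_commute)

lemma peirce_cnj: "v \<in> peirce x \<Longrightarrow> cnj v = - v"
  by (simp add: peirce_tr cnj_trace_zero)

lemma peirce_square: "v \<in> peirce x \<Longrightarrow> v \<cdot> v = 0"
  by (simp add: square_eq peirce_tr peirce_norm)

lemma peirce_anticommute: "v \<in> peirce x \<Longrightarrow> v' \<in> peirce x \<Longrightarrow> v \<cdot> v' = - (v' \<cdot> v)"
  using mult_add_mult_commute[of v v']
  by (simp add: peirce_tr peirce_pol eq_neg_iff_add_eq_0)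

text \<open>The product of two vectors of one component behaves like a cross product with values in
  the opposite component. Both equations are exchange identities whose scalar term (x|v) or (v'|x)
  vanishes.\<close>

lemma peirce_mult:
  assumes v: "v \<in> peirce x" "v' \<in> peirce x"
  shows "v \<cdot> v' \<in> peirce (unit - x)"
proof -
  have "x \<cdot> (v \<cdot> v') = 0"
    using cnj_exchange_left[of x v v'] v x
    by (simp add: peirce_cnj cnj_mult peirce_pol_idem idem_def mult_simps) (simp add: peirce_def)
  moreover have "(v \<cdot> v') \<cdot> x = v \<cdot> v'"
    using cnj_exchange_right[of v v' x] v x
    by (simp add: peirce_cnj mult_cnj peirce_pol_idem pol_commute[of v'] idem_def mult_simps)
      (simp add: peirce_def mult_simps)
  ultimately show ?thesis by (simp add: peirce_compl)
qed

lemma peirce_mult_opposite: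
  assumes v: "v \<in> peirce x" and u: "u \<in> peirce (unit - x)" and "tr u = 0"
  shows "v \<cdot> u = - scale (pol v u) x"
proof -
  have "- (v \<cdot> u) = scale (pol v u) x"
    using cnj_exchange_right[of x v u] v u \<open>tr u = 0\<close>
    by (simp add: cnj_trace_zero peirce_cnj peirce_compl mult_simps) (simp add: peirce_def)
  then show ?thesis by (metis minus_minus)
qed

end

lemma peirce_opposite_tr: "idem x \<Longrightarrow> u \<in> peirce (unit - x) \<Longrightarrow> tr u = 0"
  using peirce_tr idem_compl by blast

text \<open>The analogue of the double cross product identity: in the exchange identity the term
  (vu)v' collapses, as vu is a multiple of x and xv' = v'.\<close>

lemma peirce_triple:
  assumes x: "idem x" and v: "v \<in> peirce x" "v' \<in> peirce x" and u: "u \<in> peirce (unit - x)"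
  shows "(v \<cdot> v') \<cdot> u = scale (pol v u) v' - scale (pol v' u) v"
  using cnj_exchange_right[of v v' u] v x u
  by (simp add: peirce_cnj[OF x] peirce_cnj[OF idem_compl[OF x]]
      peirce_mult_opposite[OF x] peirce_opposite_tr[OF x] mult_simps)
    (simp add: peirce_def algebra_simps)

text \<open>\<open>c \<mapsto> (1 - x) \<cdot> (c \<cdot> x)\<close> is the projection onto a Peirce component along the remaining ones.\<close>

lemma peirce_projection:
  assumes x: "idem x" and n: "n \<in> peirce x"
  shows "(unit - x) \<cdot> (c \<cdot> x) \<in> peirce (unit - x)"
    and "pol ((unit - x) \<cdot> (c \<cdot> x)) n = pol c n"
proof -
  have cx: "cnj x = unit - x" using x by (simp add: cnj_def idem_def)
  have "x \<cdot> ((unit - x) \<cdot> (c \<cdot> x)) = 0"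
    using x by (simp add: mult_simps mult_mult_left idem_mult)
  moreover have "((unit - x) \<cdot> (c \<cdot> x)) \<cdot> x = (unit - x) \<cdot> (c \<cdot> x)"
    using x by (simp add: mult_simps flexible[symmetric] mult_mult_right idem_mult)
  ultimately show "(unit - x) \<cdot> (c \<cdot> x) \<in> peirce (unit - x)"
    by (simp add: peirce_compl)
  \<comment> \<open>Both multiplications move to n by adjointness, and n is fixed by left
    multiplication by x and by right multiplication by \<open>unit - x\<close>.\<close>
  have "pol ((unit - x) \<cdot> (c \<cdot> x)) n = pol (c \<cdot> x) (x \<cdot> n)"
    by (metis cx pol_adjoint_left pol_commute)
  also have "\<dots> = pol c (n \<cdot> (unit - x))"
    using n by (simp add: pol_adjoint_right cx peirce_def)
  also have "\<dots> = pol c n"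
    using n by (simp add: peirce_def mult_simps)
  finally show "pol ((unit - x) \<cdot> (c \<cdot> x)) n = pol c n" .
qed

end

section \<open>Frames\<close>

text \<open>The volume is -1 rather than 1 because \<open>peirce_mult_opposite\<close> carries a
  minus sign; thus the product of each v with its partner w is \<open>e\<close>, and in the reverse
  order \<open>f\<close>.\<close>

locale zorn_frame = octonion_algebra +
  fixes e v1 v2 v3
  assumes e: "idem e"
    and v: "v1 \<in> peirce e" "v2 \<in> peirce e" "v3 \<in> peirce e"
    and volume: "pol v1 (v2 \<cdot> v3) = -1"
begin

definition "f = unit - e"
definition "w1 = v2 \<cdot> v3"
definition "w2 = v3 \<cdot> v1"
definition "w3 = v1 \<cdot> v2"

lemma w: "w1 \<in> peirce f" "w2 \<in> peirce f" "w3 \<in> peirce f"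
  using v e by (simp_all add: w1_def w2_def w3_def f_def peirce_mult)

lemma f: "idem f" using e by (simp add: f_def idem_compl)

lemma volume_cyclic: "pol v2 w2 = -1" "pol v3 w3 = -1" "pol v1 w1 = -1"
proof -
  \<comment> \<open>The volume form is invariant under cyclic shifts: move c across the polar form,
    where conjugation is a sign, then anticommute.\<close>
  have cyc: "pol b (c \<cdot> a) = pol a (b \<cdot> c)"
    if "a \<in> peirce e" "b \<in> peirce e" "c \<in> peirce e" for a b c
    using pol_adjoint_right[of b c a] that
    by (simp add: peirce_cnj[OF e] mult_simps pol_simps peirce_anticommute[OF e, of a c] pol_commute)
  show "pol v2 w2 = -1" "pol v3 w3 = -1" "pol v1 w1 = -1"
    using volume cyc[of v1 v2 v3] cyc[of v2 v3 v1] v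
    by (simp_all add: w1_def w2_def w3_def)
qed

lemma pol_ef: "pol e e = 0" "pol f f = 0" "pol e f = 1" "pol f e = 1"
  using e f by (auto simp: idem_def pol_self)
    (auto simp: f_def pol_simps pol_self pol_commute[of unit] simp flip: tr_def)

text \<open>In each pair the v is also a factor of the w, as in w2 = v3 v1, so its norm 0 factors
  out.\<close>

lemma pol_vw_zero:
  "pol v1 w2 = 0" "pol v1 w3 = 0" "pol v2 w1 = 0" "pol v2 w3 = 0" "pol v3 w1 = 0" "pol v3 w2 = 0"
  using pol_mult_left[of _ unit] pol_mult_right[of unit _ _] v
  by (simp_all add: w1_def w2_def w3_def unit_left unit_right peirce_norm[OF e])

lemma pol_idem_zero:
  "pol e v1 = 0" "pol e v2 = 0" "pol e v3 = 0" "pol e w1 = 0" "pol e w2 = 0" "pol e w3 = 0"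
  "pol f v1 = 0" "pol f v2 = 0" "pol f v3 = 0" "pol f w1 = 0" "pol f w2 = 0" "pol f w3 = 0"
  using v w peirce_pol_idem[OF e] peirce_pol_idem[OF f] peirce_tr[OF e] peirce_tr[OF f]
  by (auto simp: f_def pol_simps pol_commute[of unit] simp flip: tr_def)

lemma pol_same_zero:
  "a \<in> {v1, v2, v3} \<Longrightarrow> b \<in> {v1, v2, v3} \<Longrightarrow> pol a b = 0"
  "a \<in> {w1, w2, w3} \<Longrightarrow> b \<in> {w1, w2, w3} \<Longrightarrow> pol a b = 0"
  using v w peirce_pol[OF e] peirce_pol[OF f] by auto

lemma pol_swap:
  "pol f e = 1"
  "pol v1 e = 0" "pol v2 e = 0" "pol v3 e = 0" "pol w1 e = 0" "pol w2 e = 0" "pol w3 e = 0"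
  "pol v1 f = 0" "pol v2 f = 0" "pol v3 f = 0" "pol w1 f = 0" "pol w2 f = 0" "pol w3 f = 0"
  "pol w2 v1 = 0" "pol w3 v1 = 0" "pol w1 v2 = 0" "pol w3 v2 = 0" "pol w1 v3 = 0" "pol w2 v3 = 0"
  "pol w1 v1 = -1" "pol w2 v2 = -1" "pol w3 v3 = -1"
  using pol_ef pol_vw_zero pol_idem_zero volume_cyclic by (simp_all only: pol_commute)

lemmas pol_table = pol_ef pol_vw_zero pol_idem_zero volume_cyclic pol_same_zero pol_swap

lemma mult_table_idem:
  "e \<cdot> e = e" "f \<cdot> f = f" "e \<cdot> f = 0" "f \<cdot> e = 0"
  "e \<cdot> v1 = v1" "e \<cdot> v2 = v2" "e \<cdot> v3 = v3" "e \<cdot> w1 = 0" "e \<cdot> w2 = 0" "e \<cdot> w3 = 0"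
  "v1 \<cdot> e = 0" "v2 \<cdot> e = 0" "v3 \<cdot> e = 0" "w1 \<cdot> e = w1" "w2 \<cdot> e = w2" "w3 \<cdot> e = w3"
  "f \<cdot> v1 = 0" "f \<cdot> v2 = 0" "f \<cdot> v3 = 0" "f \<cdot> w1 = w1" "f \<cdot> w2 = w2" "f \<cdot> w3 = w3"
  "v1 \<cdot> f = v1" "v2 \<cdot> f = v2" "v3 \<cdot> f = v3" "w1 \<cdot> f = 0" "w2 \<cdot> f = 0" "w3 \<cdot> f = 0"
  using v w idem_mult[OF e] by (simp_all add: peirce_def f_def mult_simps)

lemma mult_table_same:
  "v1 \<cdot> v1 = 0" "v1 \<cdot> v2 = w3" "v1 \<cdot> v3 = - w2"
  "v2 \<cdot> v1 = - w3" "v2 \<cdot> v2 = 0" "v2 \<cdot> v3 = w1"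
  "v3 \<cdot> v1 = w2" "v3 \<cdot> v2 = - w1" "v3 \<cdot> v3 = 0"
  "w1 \<cdot> w1 = 0" "w1 \<cdot> w2 = - v3" "w1 \<cdot> w3 = v2"
  "w2 \<cdot> w1 = v3" "w2 \<cdot> w2 = 0" "w2 \<cdot> w3 = - v1"
  "w3 \<cdot> w1 = - v2" "w3 \<cdot> w2 = v1" "w3 \<cdot> w3 = 0"
proof -
  note anti = peirce_anticommute[OF e] peirce_anticommute[OF f]
  show vv: "v1 \<cdot> v1 = 0" "v1 \<cdot> v2 = w3" "v1 \<cdot> v3 = - w2"
    "v2 \<cdot> v1 = - w3" "v2 \<cdot> v2 = 0" "v2 \<cdot> v3 = w1"
    "v3 \<cdot> v1 = w2" "v3 \<cdot> v2 = - w1" "v3 \<cdot> v3 = 0"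
    using v anti(1)[of v1 v3] anti(1)[of v2 v1] anti(1)[of v3 v2]
    by (simp_all add: peirce_square[OF e] w1_def w2_def w3_def)
  show sq: "w1 \<cdot> w1 = 0" "w2 \<cdot> w2 = 0" "w3 \<cdot> w3 = 0"
    using w by (simp_all add: peirce_square[OF f])
  \<comment> \<open>Each left factor is itself a product of two v's, so \<open>peirce_triple\<close>
    applies, and only one of its two pairings is non-zero.\<close>
  show w12: "w1 \<cdot> w2 = - v3" and w23: "w2 \<cdot> w3 = - v1" and w31: "w3 \<cdot> w1 = - v2"
    using peirce_triple[OF e, of v2 v3 w2] peirce_triple[OF e, of v3 v1 w3]
      peirce_triple[OF e, of v1 v2 w1] v w
    by (simp_all add: vv pol_table f_def[symmetric])
  show "w2 \<cdot> w1 = v3" "w3 \<cdot> w2 = v1" "w1 \<cdot> w3 = v2"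
    using anti(2)[of w2 w1] anti(2)[of w3 w2] anti(2)[of w1 w3] w w12 w23 w31 by simp_all
qed

lemma mult_table_opposite:
  "v1 \<cdot> w1 = e" "v1 \<cdot> w2 = 0" "v1 \<cdot> w3 = 0"
  "v2 \<cdot> w1 = 0" "v2 \<cdot> w2 = e" "v2 \<cdot> w3 = 0"
  "v3 \<cdot> w1 = 0" "v3 \<cdot> w2 = 0" "v3 \<cdot> w3 = e"
  "w1 \<cdot> v1 = f" "w1 \<cdot> v2 = 0" "w1 \<cdot> v3 = 0"
  "w2 \<cdot> v1 = 0" "w2 \<cdot> v2 = f" "w2 \<cdot> v3 = 0"
  "w3 \<cdot> v1 = 0" "w3 \<cdot> v2 = 0" "w3 \<cdot> v3 = f"
proof -
  have vw: "a \<cdot> b = - scale (pol a b) e" if "a \<in> peirce e" "b \<in> peirce f" for a b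
    using peirce_mult_opposite[OF e that(1)] that(2) peirce_tr[OF f] by (simp add: f_def)
  have wv: "b \<cdot> a = - scale (pol b a) f" if "a \<in> peirce e" "b \<in> peirce f" for a b
    using peirce_mult_opposite[OF f that(2)] that(1) peirce_tr[OF e] by (simp add: f_def)
  show "v1 \<cdot> w1 = e" "v1 \<cdot> w2 = 0" "v1 \<cdot> w3 = 0"
    "v2 \<cdot> w1 = 0" "v2 \<cdot> w2 = e" "v2 \<cdot> w3 = 0"
    "v3 \<cdot> w1 = 0" "v3 \<cdot> w2 = 0" "v3 \<cdot> w3 = e"
    "w1 \<cdot> v1 = f" "w1 \<cdot> v2 = 0" "w1 \<cdot> v3 = 0"
    "w2 \<cdot> v1 = 0" "w2 \<cdot> v2 = f" "w2 \<cdot> v3 = 0"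
    "w3 \<cdot> v1 = 0" "w3 \<cdot> v2 = 0" "w3 \<cdot> v3 = f"
    by (simp_all add: vw wv v w pol_table)
qed

lemmas mult_table = mult_table_idem mult_table_same mult_table_opposite

text \<open>The polar form pairs \<open>e\<close> with \<open>f\<close> and each v with its w.
  Adding the vectors one at a time, the partner of the new vector is orthogonal to all earlier ones,
  so the dimension grows to 8. Eight spanning vectors are then independent.\<close>

lemma span_frame: "span {e, f, v1, v2, v3, w1, w2, w3} = UNIV"
  and independent_frame: "independent {e, f, v1, v2, v3, w1, w2, w3}"
proof -
  let ?B = "{e, f, v1, v2, v3, w1, w2, w3}"
  have "dim {w3} = Suc (dim {})"
    by (rule dim_insert_pol[where y = v3]) (simp_all add: pol_table)
  moreover have "dim {w2, w3} = Suc (dim {w3})"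
    by (rule dim_insert_pol[where y = v2]) (simp_all add: pol_table)
  moreover have "dim {w1, w2, w3} = Suc (dim {w2, w3})"
    by (rule dim_insert_pol[where y = v1]) (simp_all add: pol_table)
  moreover have "dim {v3, w1, w2, w3} = Suc (dim {w1, w2, w3})"
    by (rule dim_insert_pol[where y = w3]) (simp_all add: pol_table)
  moreover have "dim {v2, v3, w1, w2, w3} = Suc (dim {v3, w1, w2, w3})"
    by (rule dim_insert_pol[where y = w2]) (simp_all add: pol_table)
  moreover have "dim {v1, v2, v3, w1, w2, w3} = Suc (dim {v2, v3, w1, w2, w3})"
    by (rule dim_insert_pol[where y = w1]) (simp_all add: pol_table)
  moreover have "dim {f, v1, v2, v3, w1, w2, w3} = Suc (dim {v1, v2, v3, w1, w2, w3})"
    by (rule dim_insert_pol[where y = e]) (simp_all add: pol_table)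
  moreover have "dim ?B = Suc (dim {f, v1, v2, v3, w1, w2, w3})"
    by (rule dim_insert_pol[where y = f]) (simp_all add: pol_table)
  ultimately have dimB: "dim ?B = 8" by (simp only: dim_empty)
  then show span: "span ?B = UNIV"
    using dim_eq_full[of ?B] by (simp add: dimension_def card_oct_basis)
  show "independent ?B"
  proof (rule card_le_dim_spanning[of _ UNIV])
    have "card ?B \<le> 8"
      using card_length[of "[e, f, v1, v2, v3, w1, w2, w3]"] by simp
    then show "card ?B \<le> dim UNIV" by (simp add: card_oct_basis)
  qed (simp_all add: span)
qed

text \<open>A set literal may collapse; distinctness is what allows cardinalities of subsets of the
  frame to be counted and maps to be defined on it by cases.\<close>

lemma distinct_frame: "distinct [e, f, v1, v2, v3, w1, w2, w3]"
proof (rule card_distinct)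
  have "card {e, f, v1, v2, v3, w1, w2, w3} = dim (span {e, f, v1, v2, v3, w1, w2, w3})"
    using dim_span_eq_card_independent[OF independent_frame] by (rule sym)
  then show "card (set [e, f, v1, v2, v3, w1, w2, w3]) = length [e, f, v1, v2, v3, w1, w2, w3]"
    by (simp add: span_frame card_oct_basis)
qed

lemma dim_coordinate_subspace:
  assumes "S \<subseteq> {e, f, v1, v2, v3, w1, w2, w3}"
  shows "dim (span S) = card S"
  using assms independent_frame independent_mono dim_span_eq_card_independent by blast

end

section \<open>Translates and complements in frame coordinates\<close>

context octonion_algebra
begin

lemma span_plus_span: "span S + span T = span (S \<union> T)"
  by (auto simp: span_Un set_plus_def)

lemma left_translates_span:
  assumes "span S = UNIV"
  shows "left_translates (\<cdot>) a = span ((\<cdot>) a ` S)"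
  using module_hom.span_image[OF module_hom_mult_right, of a S] assms
  by (auto simp: left_translates_def)

lemma right_translates_span:
  assumes "span S = UNIV"
  shows "right_translates (\<cdot>) a = span ((\<lambda>x. x \<cdot> a) ` S)"
  using module_hom.span_image[OF module_hom_mult_left, of a S] assms
  by (auto simp: right_translates_def)

lemma span_neg_base: "- x \<in> S \<Longrightarrow> x \<in> span S"
  using span_neg[of "- x" S] span_base[of "- x" S] by simp

lemma span_neg_iff: "- x \<in> span S \<longleftrightarrow> x \<in> span S"
  using span_neg[of x S] span_neg[of "- x" S] by auto

lemma subalgebra_spanI:
  assumes "\<And>a b. a \<in> S \<Longrightarrow> b \<in> S \<Longrightarrow> a \<cdot> b \<in> span S"
  shows "subalgebra scale (\<cdot>) (span S)"
proof -
  have left: "a \<cdot> y \<in> span S" if "a \<in> S" "y \<in> span S" for a y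
    using that(2)
    by (induction y rule: span_induct_alt) (auto simp: mult_simps span_zero span_add span_scale assms that)
  have "x \<cdot> y \<in> span S" if "x \<in> span S" "y \<in> span S" for x y
    using that(1)
    by (induction x rule: span_induct_alt) (auto simp: mult_simps span_zero span_add span_scale left that(2))
  then show ?thesis by (simp add: subalgebra_def)
qed

end

context zorn_frame
begin

lemma left_translates_v1: "left_translates (\<cdot>) v1 = span {e, v1, w2, w3}"
  unfolding left_translates_span[OF span_frame]
  by (subst span_eq) (simp add: mult_table span_base span_zero span_neg_iff span_neg_base)

lemma right_translates_v1: "right_translates (\<cdot>) v1 = span {f, v1, w2, w3}"
  unfolding right_translates_span[OF span_frame]
  by (subst span_eq) (simp add: mult_table span_base span_zero span_neg_iff span_neg_base)

lemma left_translates_w2: "left_translates (\<cdot>) w2 = span {f, v1, v3, w2}"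
  unfolding left_translates_span[OF span_frame]
  by (subst span_eq) (simp add: mult_table span_base span_zero span_neg_iff span_neg_base)

lemma right_translates_w2: "right_translates (\<cdot>) w2 = span {e, v1, v3, w2}"
  unfolding right_translates_span[OF span_frame]
  by (subst span_eq) (simp add: mult_table span_base span_zero span_neg_iff span_neg_base)

lemma both_translates_v1:
  "left_translates (\<cdot>) v1 + right_translates (\<cdot>) v1 = span {e, f, v1, w2, w3}"
  unfolding left_translates_v1 right_translates_v1 span_plus_span
  by (rule arg_cong[of _ _ span]) auto

lemma left_translates_v1_w2:
  "left_translates (\<cdot>) v1 + left_translates (\<cdot>) w2 = span {e, f, v1, v3, w2, w3}"
  unfolding left_translates_v1 left_translates_w2 span_plus_span
  by (rule arg_cong[of _ _ span]) auto

lemma right_translates_v1_w2: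
  "right_translates (\<cdot>) v1 + right_translates (\<cdot>) w2 = span {e, f, v1, v3, w2, w3}"
  unfolding right_translates_v1 right_translates_w2 span_plus_span
  by (rule arg_cong[of _ _ span]) auto

lemma dim_both_translates_v1: "dim (left_translates (\<cdot>) v1 + right_translates (\<cdot>) v1) = 5"
  using dim_coordinate_subspace[of "{e, f, v1, w2, w3}"] distinct_frame
  by (simp add: both_translates_v1 del: dim_span)

lemma subalgebra_both_translates_v1:
  "subalgebra scale (\<cdot>) (left_translates (\<cdot>) v1 + right_translates (\<cdot>) v1)"
  unfolding both_translates_v1
  by (rule subalgebra_spanI) (auto simp: mult_table span_zero span_neg_iff span_base)

text \<open>The six vectors are those whose partner is neither \<open>v1\<close> nor
  \<open>w2\<close>. One inclusion is read off the polar table; equality follows from 6 = 8 -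
  2.\<close>

lemma perp_v1_w2: "perp {v1, w2} = span {e, f, v1, v3, w2, w3}"
proof (rule subspace_dim_equal[symmetric])
  show "span {e, f, v1, v3, w2, w3} \<subseteq> perp {v1, w2}"
    by (rule span_minimal[OF _ subspace_perp]) (simp add: orthogonal_complement_def pol_table)
  have "dim {v1, w2} = 2"
    using dim_coordinate_subspace[of "{v1, w2}"] distinct_frame by simp
  then show "dim (perp {v1, w2}) \<le> dim (span {e, f, v1, v3, w2, w3})"
    using dim_perp[of "{v1, w2}"] dim_coordinate_subspace[of "{e, f, v1, v3, w2, w3}"] distinct_frame
    by simp
qed (simp_all add: subspace_perp)

lemma dim_perp_v1_w2: "dim (perp {v1, w2}) = 6"
  using dim_coordinate_subspace[of "{e, f, v1, v3, w2, w3}"] distinct_frame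
  by (simp add: perp_v1_w2 del: dim_span)

lemma subalgebra_perp_v1_w2: "subalgebra scale (\<cdot>) (perp {v1, w2})"
  unfolding perp_v1_w2
  by (rule subalgebra_spanI) (auto simp: mult_table span_zero span_neg_iff span_base)

end

section \<open>Conjugacy of frames, and frames through given nilpotents\<close>

context octonion_algebra
begin

text \<open>The multiplication table does not depend on the frame, so frames are conjugate.\<close>

lemma frames_conjugate:
  assumes A: "zorn_frame scale (\<cdot>) unit N e v1 v2 v3"
    and B: "zorn_frame scale (\<cdot>) unit N e' v1' v2' v3'"
  obtains g where "g \<in> automorphisms scale (\<cdot>)" "g v1 = v1'" "g (v3 \<cdot> v1) = v3' \<cdot> v1'"
proof -
  interpret A: zorn_frame scale "(\<cdot>)" unit N e v1 v2 v3 by (rule A)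
  interpret B: zorn_frame scale "(\<cdot>)" unit N e' v1' v2' v3' by (rule B)
  interpret P: vector_space_pair scale scale by unfold_locales
  let ?A = "{e, A.f, v1, v2, v3, A.w1, A.w2, A.w3}"
  \<comment> \<open>The frame is distinct, so each case reaches its own vector; the final default is
    the value at \<open>w3\<close>.\<close>
  define h where "h x = (if x = e then e' else if x = A.f then B.f else if x = v1 then v1' else
    if x = v2 then v2' else if x = v3 then v3' else if x = A.w1 then B.w1 else
    if x = A.w2 then B.w2 else B.w3)" for x
  obtain g where g: "Vector_Spaces.linear scale scale g" and "\<forall>x\<in>?A. g x = h x"
    using P.linear_independent_extend[OF A.independent_frame, of h] by blast
  then have g_frame: "g e = e'" "g A.f = B.f" "g v1 = v1'" "g v2 = v2'" "g v3 = v3'"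
    "g A.w1 = B.w1" "g A.w2 = B.w2" "g A.w3 = B.w3"
    using A.distinct_frame by (auto simp: h_def)
  interpret g: Vector_Spaces.linear scale scale g by (rule g)
  have "g ` UNIV = span (g ` ?A)"
    by (simp only: g.span_image A.span_frame)
  also have "g ` ?A = {e', B.f, v1', v2', v3', B.w1, B.w2, B.w3}"
    by (simp add: g_frame)
  finally have surj: "surj g" by (simp only: B.span_frame)
  then have bij: "bij g"
    using linear_surj_imp_inj[OF g] by (simp add: bij_def)
  have frame: "g (a \<cdot> b) = g a \<cdot> g b" if "a \<in> ?A" "b \<in> ?A" for a b
    using that by (auto simp: A.mult_table B.mult_table g_frame g.neg g.zero)
  have left: "g (a \<cdot> y) = g a \<cdot> g y" if "a \<in> ?A" "y \<in> span ?A" for a y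
    using that(2)
    by (induction y rule: span_induct_alt) (simp_all add: mult_simps g.add g.scale g.zero frame[OF that(1)])
  have "g (x \<cdot> y) = g x \<cdot> g y" if "x \<in> span ?A" "y \<in> span ?A" for x y
    using that(1)
    by (induction x rule: span_induct_alt) (simp_all add: mult_simps g.add g.scale g.zero left[OF _ that(2)])
  then have "g \<in> automorphisms scale (\<cdot>)"
    using bij g by (simp add: automorphisms_def A.span_frame)
  with that g_frame show ?thesis by (simp add: A.w2_def B.w2_def)
qed

lemma nilpotent_norm_tr:
  assumes "nilpotent (\<cdot>) n"
  shows "N n = 0" "tr n = 0" "cnj n = - n"
proof -
  have sq: "n \<cdot> n = 0" using assms by (simp add: nilpotent_def)
  then show N: "N n = 0" using norm_mult[of n n] by (simp add: norm_zero)
  have "scale (tr n) n = 0" using square_eq[of n] sq N by simp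
  \<comment> \<open>Either the scalar or n vanishes, and tr(0) = 0.\<close>
  then show "tr n = 0" by (auto simp: tr_zero)
  then show "cnj n = - n" by (rule cnj_trace_zero)
qed

lemma nilpotent_iff: "nilpotent (\<cdot>) n \<longleftrightarrow> N n = 0 \<and> tr n = 0"
  using nilpotent_norm_tr[of n] square_eq[of n] by (auto simp: nilpotent_def)

text \<open>For nilpotent n the trace of ny is -(n|y), whence the normalization -1. Alternativity
  gives n(ny) = 0, and the anticommutator formula then gives (ny)n = n.\<close>

lemma idem_of_nilpotent:
  assumes n: "nilpotent (\<cdot>) n" and y: "pol y n = -1"
  shows "idem (n \<cdot> y)" "n \<in> peirce (n \<cdot> y)"
proof -
  note nil = nilpotent_norm_tr[OF n]
  show x: "idem (n \<cdot> y)"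
    using y by (simp add: idem_def norm_mult tr_mult nil pol_commute[of n])
  have "n \<cdot> (n \<cdot> y) = 0"
    using n by (simp add: mult_mult_left nilpotent_def mult_simps)
  moreover have "pol n (n \<cdot> y) = 0"
    using pol_mult_left[of n unit y] by (simp add: mult_simps nil)
  ultimately have "(n \<cdot> y) \<cdot> n = n"
    using mult_add_mult_commute[of n "n \<cdot> y"] x by (simp add: nil idem_def)
  with \<open>n \<cdot> (n \<cdot> y) = 0\<close> show "n \<in> peirce (n \<cdot> y)"
    by (simp add: peirce_def)
qed

lemma exists_pol_minus_one:
  assumes "subspace S" "y \<in> S" "pol y n \<noteq> 0"
  shows "\<exists>y\<in>S. pol y n = -1"
  using assms by (intro bexI[of _ "scale (- inverse (pol y n)) y"]) (simp_all add: pol_simps subspace_scale subspace_neg)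

lemma annihilating_commute:
  assumes "nilpotent (\<cdot>) n" "nilpotent (\<cdot>) m" "n \<cdot> m = 0"
  shows "m \<cdot> n = 0" "pol n m = 0"
proof -
  show p: "pol n m = 0"
    using tr_mult[of n m] assms by (simp add: nilpotent_norm_tr tr_zero)
  show "m \<cdot> n = 0"
    using mult_add_mult_commute[of n m] assms p by (simp add: nilpotent_norm_tr)
qed

text \<open>With y orthogonal to m, the idempotent x = ny has n in its component and m in the
  opposite one. Projecting suitable elements onto the components gives w with (w|n) = -1 and v2 with
  (v2|m) = -1; then v3 = -wm completes the frame.\<close>

lemma frame_of_pair:
  assumes n: "nilpotent (\<cdot>) n" and m: "nilpotent (\<cdot>) m"
    and nm: "n \<cdot> m = 0" and indep: "n \<notin> span {m}" "m \<noteq> 0"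
  obtains e v2 v3 where "zorn_frame scale (\<cdot>) unit N e n v2 v3" "v3 \<cdot> n = m"
proof -
  \<comment> \<open>Independence is used here: n is not in the double complement of m, so some
    vector orthogonal to m pairs non-trivially with n.\<close>
  have "n \<notin> perp (perp {m})" using indep by (simp add: perp_perp)
  then obtain y0 where "y0 \<in> perp {m}" "pol y0 n \<noteq> 0"
    by (auto simp: orthogonal_complement_def pol_commute)
  then obtain y where y: "y \<in> perp {m}" "pol y n = -1"
    using exists_pol_minus_one[OF subspace_perp] by blast
  define x where "x = n \<cdot> y"
  have x: "idem x" "n \<in> peirce x"
    using idem_of_nilpotent[OF n y(2)] by (simp_all add: x_def)
  have ym: "pol y m = 0" using y by (simp add: orthogonal_complement_def)
  have "x \<cdot> m = 0"
    using cnj_exchange_right[of n y m]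
    by (simp add: x_def nm ym nilpotent_norm_tr[OF m] mult_simps)
  moreover have "pol x m = 0"
    using pol_adjoint_left[of n y m] nm
    by (simp add: x_def nilpotent_norm_tr[OF n] mult_simps pol_simps)
  ultimately have "m \<cdot> x = m"
    using mult_add_mult_commute[of x m] x by (simp add: nilpotent_norm_tr[OF m] idem_def)
  with \<open>x \<cdot> m = 0\<close> have m_peirce: "m \<in> peirce (unit - x)"
    by (simp add: peirce_compl)
  have x': "idem (unit - x)" using x(1) by (rule idem_compl)
  \<comment> \<open>The projection puts y into the component opposite to n without changing its
    pairing with n.\<close>
  define w where "w = (unit - x) \<cdot> (y \<cdot> x)"
  have w: "w \<in> peirce (unit - x)" "pol w n = -1"
    using peirce_projection[OF x, of y] y by (simp_all add: w_def)
  obtain c0 where "pol c0 m \<noteq> 0"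
    using indep(2) eqI_pol[of m 0] by (auto simp: pol_simps pol_commute)
  then obtain c where c: "pol c m = -1"
    using exists_pol_minus_one[OF subspace_UNIV] by blast
  define v2 where "v2 = (unit - (unit - x)) \<cdot> (c \<cdot> (unit - x))"
  have v2: "v2 \<in> peirce x" "pol v2 m = -1"
    using peirce_projection[OF x' m_peirce, of c] c by (simp_all add: v2_def)
  define v3 where "v3 = - (w \<cdot> m)"
  have "w \<cdot> m \<in> peirce x"
    using peirce_mult[OF x' w(1) m_peirce] by simp
  then have v3: "v3 \<in> peirce x"
    by (simp add: v3_def peirce_def mult_simps)
  have v3n: "v3 \<cdot> n = m"
    using peirce_triple[OF x' w(1) m_peirce, of n] x(2) w(2) annihilating_commute[OF n m nm]
    by (simp add: v3_def mult_simps pol_commute[of m])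
  \<comment> \<open>Cyclicity of the volume reduces it to (v2|m), which was normalized to
    -1.\<close>
  have "pol n (v2 \<cdot> v3) = pol v2 (v3 \<cdot> n)"
  proof -
    have "pol (v2 \<cdot> v3) n = pol v2 (n \<cdot> (- v3))"
      using peirce_cnj[OF x(1) v3] by (simp add: pol_adjoint_right)
    also have "n \<cdot> (- v3) = v3 \<cdot> n"
      using peirce_anticommute[OF x(1,2) v3] by (simp add: mult_simps)
    finally show ?thesis by (simp add: pol_commute)
  qed
  then have "pol n (v2 \<cdot> v3) = -1" using v2 v3n by simp
  then have "zorn_frame scale (\<cdot>) unit N x n v2 v3"
    using x v2 v3 by unfold_locales simp_all
  then show ?thesis using that v3n by blast
qed

text \<open>For the idempotent x = ny, every c orthogonal to \<open>unit\<close>, x and n splits as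
  xc + cx. The space of such c has dimension at least 5, so the polar form is non-zero on it and it
  does not lie in the isotropic component of x. Hence some cx is non-zero; it lies in the opposite
  component and is the partner.\<close>

lemma exists_annihilating_partner:
  assumes n: "nilpotent (\<cdot>) n" "n \<noteq> 0"
  obtains m where "nilpotent (\<cdot>) m" "n \<cdot> m = 0" "n \<notin> span {m}" "m \<noteq> 0"
proof -
  obtain y0 where "pol y0 n \<noteq> 0"
    using n(2) eqI_pol[of n 0] by (auto simp: pol_simps pol_commute)
  then obtain y where y: "pol y n = -1"
    using exists_pol_minus_one[OF subspace_UNIV] by blast
  define x where "x = n \<cdot> y"
  have x: "idem x" "n \<in> peirce x"
    using idem_of_nilpotent[OF n(1) y] by (simp_all add: x_def)
  have comm: "x \<cdot> c + c \<cdot> x = c" if "c \<in> perp {unit, x, n}" for c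
    using that mult_add_mult_commute[of x c] x(1)
    by (simp add: orthogonal_complement_def tr_def[symmetric] idem_def pol_commute)
  have "dim {unit, x, n} \<le> 3"
    using dim_le_card[of "{unit, x, n}" "{unit, x, n}"] card_length[of "[unit, x, n]"]
    by (simp add: span_superset)
  then have "dim (perp {unit, x, n}) > 4"
    using dim_perp[of "{unit, x, n}"] by simp
  then have "\<not> perp {unit, x, n} \<subseteq> perp (perp {unit, x, n})"
    using isotropic_dim_le[of "perp {unit, x, n}"] by linarith
  then obtain a b where ab: "a \<in> perp {unit, x, n}" "b \<in> perp {unit, x, n}" "pol a b \<noteq> 0"
    unfolding orthogonal_complement_def[of N "perp {unit, x, n}"] by blast
  have "a \<cdot> x \<noteq> 0 \<or> b \<cdot> x \<noteq> 0"
    using comm[OF ab(1)] comm[OF ab(2)] ab(3) peirce_pol[OF x(1), of a b]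
    by (auto simp: peirce_def)
  then obtain c where c: "c \<in> perp {unit, x, n}" "c \<cdot> x \<noteq> 0"
    using ab by blast
  have xc: "x \<cdot> c = c - c \<cdot> x"
    using comm[OF c(1)] by (simp add: algebra_simps)
  have "x \<cdot> (c \<cdot> x) = 0"
  proof -
    have "c \<cdot> x = c - x \<cdot> c" by (simp add: xc)
    then have "x \<cdot> (c \<cdot> x) = x \<cdot> c - x \<cdot> (x \<cdot> c)" by (simp only: mult_diff_right)
    then show ?thesis by (simp only: mult_mult_left idem_mult[OF x(1)] diff_self)
  qed
  moreover have "(c \<cdot> x) \<cdot> x = c \<cdot> x"
    using x(1) by (simp add: mult_mult_right idem_mult)
  ultimately have cx: "c \<cdot> x \<in> peirce (unit - x)"
    by (simp add: peirce_compl)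
  have "x \<cdot> c \<in> peirce x"
    using \<open>x \<cdot> (c \<cdot> x) = 0\<close>
    by (simp only: peirce_def mem_Collect_eq mult_mult_left idem_mult[OF x(1)] flexible simp_thms)
  \<comment> \<open>The summand xc lies in the same component as n, so it is orthogonal to n; as c
    is too, so is cx.\<close>
  then have "pol (x \<cdot> c) n = 0" using peirce_pol[OF x(1) _ x(2)] by simp
  then have "pol (c \<cdot> x) n = 0"
    using c(1) xc by (simp add: orthogonal_complement_def pol_simps)
  then have "n \<cdot> (c \<cdot> x) = 0"
    using peirce_mult_opposite[OF x cx] peirce_opposite_tr[OF x(1) cx] by (simp add: pol_commute)
  moreover have "nilpotent (\<cdot>) (c \<cdot> x)"
    using cx idem_compl[OF x(1)] by (simp add: nilpotent_def peirce_square)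
  moreover have "n \<notin> span {c \<cdot> x}"
  proof
    assume "n \<in> span {c \<cdot> x}"
    then obtain k where "n = scale k (c \<cdot> x)" by (auto simp: span_singleton)
    then have "x \<cdot> n = 0"
      using \<open>x \<cdot> (c \<cdot> x) = 0\<close> by (simp add: mult_simps)
    then show False using x(2) n(2) by (simp add: peirce_def)
  qed
  ultimately show ?thesis using that c(2) by blast
qed

text \<open>A singular element of trace 0 is nilpotent already. Otherwise a multiple of it is an
  idempotent e, and for non-zero c orthogonal to \<open>unit\<close> and e the decomposition c = ec
  + ce has nilpotent terms, not both 0.\<close>

lemma exists_nilpotent:
  assumes "split_norm N"
  obtains n where "nilpotent (\<cdot>) n" "n \<noteq> 0"
proof -
  obtain x where x: "x \<noteq> 0" "N x = 0" using assms by (auto simp: split_norm_def)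
  show ?thesis
  proof (cases "tr x = 0")
    case True
    then show ?thesis using that x by (simp add: nilpotent_iff)
  next
    case False
    define e where "e = scale (inverse (tr x)) x"
    have e: "idem e" using False x by (simp add: e_def idem_def norm_scale tr_simps)
    have "card {unit, e} < 8" using card_length[of "[unit, e]"] by simp
    then obtain c where c: "c \<in> perp {unit, e}" "c \<noteq> 0"
      using dim_perp_pos[of "{unit, e}"] by auto
    have tr_c: "tr c = 0" "pol e c = 0"
      using c(1) by (auto simp: orthogonal_complement_def tr_def pol_commute)
    have "e \<cdot> c + c \<cdot> e = c"
      using mult_add_mult_commute[of e c] e tr_c by (simp add: idem_def)
    then have "e \<cdot> c \<noteq> 0 \<or> c \<cdot> e \<noteq> 0" using c(2) by auto
    moreover have "nilpotent (\<cdot>) (e \<cdot> c)" "nilpotent (\<cdot>) (c \<cdot> e)"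
      using e tr_c by (simp_all add: nilpotent_iff norm_mult tr_mult idem_def pol_commute)
    ultimately show ?thesis using that by blast
  qed
qed

end

section \<open>The two orbits under the automorphism group\<close>

context octonion_algebra
begin

lemma annihilating_nilpotent_pair_iff:
  "annihilating_nilpotent_pair scale (\<cdot>) m n \<longleftrightarrow>
    nilpotent (\<cdot>) m \<and> nilpotent (\<cdot>) n \<and> m \<cdot> n = 0 \<and> m \<notin> span {n} \<and> n \<noteq> 0"
  by (auto simp: annihilating_nilpotent_pair_def independent_insert span_base)

lemma frame_of_nilpotent:
  assumes "nilpotent (\<cdot>) n" "n \<noteq> 0"
  obtains e v2 v3 where "zorn_frame scale (\<cdot>) unit N e n v2 v3"
  using exists_annihilating_partner[OF assms] frame_of_pair[OF assms(1)] by metis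

lemma frame_of_annihilating_pair:
  assumes "annihilating_nilpotent_pair scale (\<cdot>) m n"
  obtains e v2 v3 where "zorn_frame scale (\<cdot>) unit N e m v2 v3" "v3 \<cdot> m = n"
  using frame_of_pair[of m n] assms by (auto simp: annihilating_nilpotent_pair_iff)

lemma dim_subalgebra_both_translates:
  assumes "nilpotent (\<cdot>) n" "n \<noteq> 0"
  shows "dim (left_translates (\<cdot>) n + right_translates (\<cdot>) n) = 5"
    and "subalgebra scale (\<cdot>) (left_translates (\<cdot>) n + right_translates (\<cdot>) n)"
  using frame_of_nilpotent[OF assms] zorn_frame.dim_both_translates_v1
    zorn_frame.subalgebra_both_translates_v1 by metis+

lemma perp_annihilating_pair:
  assumes "annihilating_nilpotent_pair scale (\<cdot>) m n"
  shows "dim (perp {m, n}) = 6"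
    and "subalgebra scale (\<cdot>) (perp {m, n})"
    and "perp {m, n} = left_translates (\<cdot>) m + left_translates (\<cdot>) n"
    and "perp {m, n} = right_translates (\<cdot>) m + right_translates (\<cdot>) n"
proof -
  obtain e v2 v3 where "zorn_frame scale (\<cdot>) unit N e m v2 v3" and n: "v3 \<cdot> m = n"
    using frame_of_annihilating_pair[OF assms] .
  then interpret zorn_frame scale "(\<cdot>)" unit N e m v2 v3 by simp
  have n: "n = w2" using n by (simp add: w2_def)
  show "dim (perp {m, n}) = 6" "subalgebra scale (\<cdot>) (perp {m, n})"
    "perp {m, n} = left_translates (\<cdot>) m + left_translates (\<cdot>) n"
    "perp {m, n} = right_translates (\<cdot>) m + right_translates (\<cdot>) n"
    unfolding n left_translates_v1_w2 right_translates_v1_w2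
    by (rule dim_perp_v1_w2 subalgebra_perp_v1_w2 perp_v1_w2)+
qed

lemma type_a_iff:
  "subalgebra scale (\<cdot>) A \<and> type_a scale (\<cdot>) A \<longleftrightarrow>
    (\<exists>n. nilpotent (\<cdot>) n \<and> n \<noteq> 0 \<and> A = left_translates (\<cdot>) n + right_translates (\<cdot>) n)"
proof -
  \<comment> \<open>\<open>nilpotent\<close> admits 0, but the translates of 0 have dimension 0, so
    the dimension 5 in \<open>type_a\<close> forces n to be non-zero.\<close>
  have "dim (left_translates (\<cdot>) 0 + right_translates (\<cdot>) 0) = 0"
    by (simp only: dim_eq_0) (auto simp: left_translates_def right_translates_def set_plus_def mult_simps)
  then show ?thesis
    using dim_subalgebra_both_translates unfolding type_a_def by (metis zero_neq_numeral)
qed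

lemma type_b_iff:
  "subalgebra scale (\<cdot>) A \<and> type_b scale (\<cdot>) N A \<longleftrightarrow>
    (\<exists>m n. annihilating_nilpotent_pair scale (\<cdot>) m n \<and> A = perp {m, n})"
  using perp_annihilating_pair unfolding type_b_def by metis

context
  fixes g assumes g: "g \<in> automorphisms scale (\<cdot>)"
begin

interpretation g: Vector_Spaces.linear scale scale g
  using g by (simp add: automorphisms_def)

lemma automorphism_mult: "g (x \<cdot> y) = g x \<cdot> g y"
  and automorphism_bij: "bij g"
  using g by (auto simp: automorphisms_def)

lemma automorphism_translates:
  "g ` left_translates (\<cdot>) a = left_translates (\<cdot>) (g a)"
  "g ` right_translates (\<cdot>) a = right_translates (\<cdot>) (g a)"
proof -
  have "\<exists>y. x = g y" for x using automorphism_bij by (metis bij_pointE)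
  then show "g ` left_translates (\<cdot>) a = left_translates (\<cdot>) (g a)"
    "g ` right_translates (\<cdot>) a = right_translates (\<cdot>) (g a)"
    by (auto simp: left_translates_def right_translates_def image_iff)
      (metis automorphism_mult)+
qed

lemma automorphism_plus: "g ` (S + T) = g ` S + g ` T"
  by (force simp: set_plus_def image_iff g.add)

lemma automorphism_nilpotent: "nilpotent (\<cdot>) n \<Longrightarrow> nilpotent (\<cdot>) (g n)"
  by (metis nilpotent_def automorphism_mult g.zero)

lemma automorphism_nonzero: "n \<noteq> 0 \<Longrightarrow> g n \<noteq> 0"
  using automorphism_bij by (metis g.zero bij_is_inj injD)

lemma automorphism_annihilating_pair:
  assumes "annihilating_nilpotent_pair scale (\<cdot>) m n"
  shows "annihilating_nilpotent_pair scale (\<cdot>) (g m) (g n)"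
proof -
  have "g m \<notin> span {g n}" if "m \<notin> span {n}"
  proof
    assume "g m \<in> span {g n}"
    then obtain k where "g m = g (scale k n)" by (auto simp: span_singleton g.scale)
    then have "m = scale k n" using automorphism_bij by (meson bij_is_inj injD)
    then show False using that by (auto simp: span_singleton)
  qed
  moreover have "g m \<cdot> g n = 0" if "m \<cdot> n = 0"
    using that by (metis automorphism_mult g.zero)
  ultimately show ?thesis
    using assms unfolding annihilating_nilpotent_pair_iff
    by (simp add: automorphism_nilpotent automorphism_nonzero)
qed

end

lemma nilpotents_conjugate:
  assumes "nilpotent (\<cdot>) n" "n \<noteq> 0" "nilpotent (\<cdot>) n'" "n' \<noteq> 0"
  obtains g where "g \<in> automorphisms scale (\<cdot>)" "g n = n'"
  using frame_of_nilpotent[OF assms(1,2)] frame_of_nilpotent[OF assms(3,4)] frames_conjugate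
  by metis

lemma annihilating_pairs_conjugate:
  assumes "annihilating_nilpotent_pair scale (\<cdot>) m n" "annihilating_nilpotent_pair scale (\<cdot>) m' n'"
  obtains g where "g \<in> automorphisms scale (\<cdot>)" "g m = m'" "g n = n'"
  using frame_of_annihilating_pair[OF assms(1)] frame_of_annihilating_pair[OF assms(2)] frames_conjugate
  by metis

lemma single_orbit_type_a:
  assumes "split_norm N"
  shows "single_orbit scale (\<cdot>) {A. subalgebra scale (\<cdot>) A \<and> type_a scale (\<cdot>) A}"
proof -
  obtain n where n: "nilpotent (\<cdot>) n" "n \<noteq> 0" using exists_nilpotent[OF assms] .
  let ?A = "\<lambda>n. left_translates (\<cdot>) n + right_translates (\<cdot>) n"
  have image: "g ` ?A k = ?A (g k)" if "g \<in> automorphisms scale (\<cdot>)" for g k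
    using that by (simp add: automorphism_plus automorphism_translates)
  have "{A. subalgebra scale (\<cdot>) A \<and> type_a scale (\<cdot>) A} = {g ` ?A n | g. g \<in> automorphisms scale (\<cdot>)}"
  proof (intro set_eqI iffI; clarsimp simp only: type_a_iff mem_Collect_eq)
    fix k assume "nilpotent (\<cdot>) k" "k \<noteq> 0"
    then obtain g where "g \<in> automorphisms scale (\<cdot>)" "g n = k"
      using nilpotents_conjugate[OF n] by blast
    then show "\<exists>g. ?A k = g ` ?A n \<and> g \<in> automorphisms scale (\<cdot>)"
      using image by metis
  next
    fix g assume g: "g \<in> automorphisms scale (\<cdot>)"
    then show "\<exists>k. nilpotent (\<cdot>) k \<and> k \<noteq> 0 \<and> g ` ?A n = ?A k"
      using image automorphism_nilpotent automorphism_nonzero n by metis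
  qed
  then show ?thesis unfolding single_orbit_def by blast
qed

lemma single_orbit_type_b:
  assumes "split_norm N"
  shows "single_orbit scale (\<cdot>) {A. subalgebra scale (\<cdot>) A \<and> type_b scale (\<cdot>) N A}"
proof -
  obtain m where m: "nilpotent (\<cdot>) m" "m \<noteq> 0" using exists_nilpotent[OF assms] .
  then obtain n where mn: "annihilating_nilpotent_pair scale (\<cdot>) m n"
    using exists_annihilating_partner[OF m] by (metis annihilating_nilpotent_pair_iff)
  \<comment> \<open>The complement is rewritten as a sum of left translates, which is expressed by
    the product alone and therefore carried along by automorphisms.\<close>
  have image: "g ` perp {a, b} = perp {g a, g b}"
    if "g \<in> automorphisms scale (\<cdot>)" "annihilating_nilpotent_pair scale (\<cdot>) a b" for g a b
    using perp_annihilating_pair(3)[OF that(2)]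
      perp_annihilating_pair(3)[OF automorphism_annihilating_pair[OF that]] that(1)
    by (simp add: automorphism_plus automorphism_translates)
  have "{A. subalgebra scale (\<cdot>) A \<and> type_b scale (\<cdot>) N A} = {g ` perp {m, n} | g. g \<in> automorphisms scale (\<cdot>)}"
  proof (intro set_eqI iffI; clarsimp simp only: type_b_iff mem_Collect_eq)
    fix a b assume "annihilating_nilpotent_pair scale (\<cdot>) a b"
    then obtain g where "g \<in> automorphisms scale (\<cdot>)" "g m = a" "g n = b"
      using annihilating_pairs_conjugate[OF mn] by blast
    then show "\<exists>g. perp {a, b} = g ` perp {m, n} \<and> g \<in> automorphisms scale (\<cdot>)"
      using image[OF _ mn] by metis
  next
    fix g assume g: "g \<in> automorphisms scale (\<cdot>)"
    then show "\<exists>a b. annihilating_nilpotent_pair scale (\<cdot>) a b \<and> g ` perp {m, n} = perp {a, b}"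
      using image mn automorphism_annihilating_pair by metis
  qed
  then show ?thesis unfolding single_orbit_def by blast
qed

section \<open>Multiplication by invertible elements, and the unit of a large subalgebra\<close>

lemma inj_mult_left: "N a \<noteq> 0 \<Longrightarrow> inj (\<lambda>x. a \<cdot> x)"
  by (rule inj_on_inverseI[where g = "\<lambda>y. scale (inverse (N a)) (cnj a \<cdot> y)"])
    (simp add: cnj_mult_cancel)

lemma inj_mult_right: "N a \<noteq> 0 \<Longrightarrow> inj (\<lambda>x. x \<cdot> a)"
  by (rule inj_on_inverseI[where g = "\<lambda>y. scale (inverse (N a)) (y \<cdot> cnj a)"])
    (simp add: mult_cnj_cancel)

lemma unit_in_subalgebra:
  assumes A: "subalgebra scale (\<cdot>) A" and dim: "dim A > 4"
  shows "unit \<in> A"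
proof -
  have sub: "subspace A" and closed: "\<And>x y. x \<in> A \<Longrightarrow> y \<in> A \<Longrightarrow> x \<cdot> y \<in> A"
    using A by (auto simp: subalgebra_def)
  have "\<not> A \<subseteq> perp A"
    using dim isotropic_dim_le[of A] by linarith
  then obtain x y where "x \<in> A" "y \<in> A" "pol x y \<noteq> 0"
    by (auto simp: orthogonal_complement_def)
  moreover from this have "N x \<noteq> 0 \<or> N y \<noteq> 0 \<or> N (x + y) \<noteq> 0"
    by (auto simp: polar_def)
  ultimately obtain a where a: "a \<in> A" "N a \<noteq> 0"
    using subspace_add[OF sub] by blast
  \<comment> \<open>Left multiplication by a maps \<open>A\<close> injectively into itself, so onto
    by dimension. Writing a = ab with b in \<open>A\<close> and cancelling a gives b =
    \<open>unit\<close>.\<close>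
  have "(\<lambda>x. a \<cdot> x) ` A = A"
  proof (rule subspace_dim_equal)
    show "subspace ((\<lambda>x. a \<cdot> x) ` A)"
      using module_hom.subspace_image[OF module_hom_mult_right sub] .
    show "dim A \<le> dim ((\<lambda>x. a \<cdot> x) ` A)"
      using dim_image_inj[OF mult_linear_right inj_mult_left[OF a(2)]] by simp
  qed (use sub a closed in auto)
  then obtain b where "b \<in> A" "a \<cdot> unit = a \<cdot> b"
    using a(1) by (metis imageE unit_right)
  then show ?thesis using inj_mult_left[OF a(2)] by (metis injD)
qed

lemma exists_independent_pair:
  assumes "dim W \<ge> 2"
  obtains m n where "m \<in> W" "n \<in> W" "n \<noteq> 0" "m \<notin> span {n}"
proof -
  have "\<not> W \<subseteq> {0}" using assms by (simp flip: dim_eq_0)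
  then obtain n where n: "n \<in> W" "n \<noteq> 0" by blast
  have "\<not> W \<subseteq> span {n}"
    using assms dim_mono[of W "{n}"] n(2) by auto
  then show ?thesis using that n by blast
qed

end

section \<open>Subalgebras of dimension greater than 4\<close>

text \<open>The complement \<open>W\<close> of a proper subalgebra of dimension greater than 4 is an ideal
  of that subalgebra, and a totally singular one, since right multiplication by a non-singular
  \<open>u \<in> W\<close> would embed the subalgebra into \<open>W\<close>.\<close>

locale large_proper_subalgebra = octonion_algebra +
  fixes A
  assumes subalgebra_A: "subalgebra scale (\<cdot>) A"
    and dim_A: "dim A > 4"
    and proper: "A \<noteq> UNIV"
begin

definition "W = perp A"

lemma subspace_A: "subspace A" and A_mult: "x \<in> A \<Longrightarrow> y \<in> A \<Longrightarrow> x \<cdot> y \<in> A"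
  using subalgebra_A by (auto simp: subalgebra_def)

lemma unit_A: "unit \<in> A"
  using subalgebra_A dim_A by (rule unit_in_subalgebra)

lemma cnj_A: "x \<in> A \<Longrightarrow> cnj x \<in> A"
  using subspace_A unit_A by (simp add: cnj_def subspace_diff subspace_scale)

lemma subspace_W: "subspace W" by (simp add: W_def subspace_perp)

lemma dim_W: "dim W + dim A = 8"
  using dim_perp[of A] by (simp add: W_def)

lemma dim_W_pos: "dim W > 0"
proof (rule ccontr)
  assume "\<not> dim W > 0"
  then have "dim A = dim UNIV" using dim_W dim_eq_8 by linarith
  then show False
    using proper subspace_dim_equal[OF subspace_A subspace_UNIV] by simp
qed

lemma pol_W: "w \<in> W \<Longrightarrow> a \<in> A \<Longrightarrow> pol w a = 0"
  by (simp add: W_def orthogonal_complement_def)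

lemma A_eq: "A = perp W"
  unfolding W_def perp_perp using span_eq_iff[THEN iffD2, OF subspace_A] by (rule sym)

lemma in_A_iff: "x \<in> A \<longleftrightarrow> (\<forall>w\<in>W. pol x w = 0)"
  by (subst A_eq) (simp add: orthogonal_complement_def)

text \<open>Adjointness moves the factor a to the other argument as its conjugate, which is again in
  \<open>A\<close>.\<close>

lemma A_W_mult: "a \<in> A \<Longrightarrow> w \<in> W \<Longrightarrow> a \<cdot> w \<in> W" "a \<in> A \<Longrightarrow> w \<in> W \<Longrightarrow> w \<cdot> a \<in> W"
  unfolding W_def orthogonal_complement_def
  by (auto simp: pol_adjoint_left[of a] pol_adjoint_right[of w a] A_mult cnj_A)

lemma norm_W: "w \<in> W \<Longrightarrow> N w = 0"
proof (rule ccontr)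
  assume w: "w \<in> W" "N w \<noteq> 0"
  have "dim ((\<lambda>x. x \<cdot> w) ` A) \<le> dim W"
    using w A_W_mult by (intro dim_subset) auto
  then show False
    using dim_image_inj[OF mult_linear_left inj_mult_right[OF w(2)], of A] dim_W dim_A by simp
qed

lemma nilpotent_W: "w \<in> W \<Longrightarrow> nilpotent (\<cdot>) w"
  using pol_W[OF _ unit_A] by (simp add: nilpotent_iff norm_W tr_def)

lemma pol_W_W: "w \<in> W \<Longrightarrow> w' \<in> W \<Longrightarrow> pol w w' = 0"
  using subspace_add[OF subspace_W, of w w'] by (simp add: polar_def norm_W)

lemma W_subset_A: "W \<subseteq> A"
  by (auto simp: in_A_iff pol_W_W)

lemma W_mult: "w \<in> W \<Longrightarrow> w' \<in> W \<Longrightarrow> w \<cdot> w' \<in> W"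
  using A_W_mult W_subset_A by blast

lemma W_anticommute: "w \<in> W \<Longrightarrow> w' \<in> W \<Longrightarrow> w \<cdot> w' = - (w' \<cdot> w)"
  using mult_add_mult_commute[of w w'] nilpotent_norm_tr[OF nilpotent_W]
  by (simp add: pol_W_W eq_neg_iff_add_eq_0)

lemma W_mult_mult:
  assumes "w \<in> W" "w' \<in> W"
  shows "w \<cdot> (w \<cdot> w') = 0" "(w \<cdot> w') \<cdot> w' = 0"
  using nilpotent_W[OF assms(1)] nilpotent_W[OF assms(2)]
  by (simp_all add: nilpotent_def mult_mult_left mult_mult_right mult_simps)

lemma split: "split_norm N"
proof -
  have "\<not> W \<subseteq> {0}" using dim_W_pos by (simp flip: dim_eq_0)
  then show ?thesis using norm_W by (auto simp: split_norm_def)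
qed

text \<open>If n spanned \<open>W\<close>, take a frame with v1 = n. Then v2 is orthogonal to n,
  hence in \<open>A\<close>, but v2 v1 = -w3 is outside the span of n, contradicting that
  \<open>W\<close> is an ideal of \<open>A\<close>.\<close>

lemma dim_W_not_1: "dim W \<noteq> 1"
proof
  assume dim1: "dim W = 1"
  then have "\<not> W \<subseteq> {0}" by (simp flip: dim_eq_0)
  then obtain n where n: "n \<in> W" "n \<noteq> 0" by blast
  have W: "span {n} = W"
    using subspace_dim_equal[of "span {n}" W] subspace_W n dim1 by (simp add: span_minimal)
  obtain e v2 v3 where "zorn_frame scale (\<cdot>) unit N e n v2 v3"
    using frame_of_nilpotent[OF nilpotent_W n(2)] n(1) by blast
  then interpret zorn_frame scale "(\<cdot>)" unit N e n v2 v3 .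
  have "v2 \<in> perp {n}" by (simp add: orthogonal_complement_def pol_table)
  then have "v2 \<in> A" by (metis A_eq W perp_span)
  then have "- w3 \<in> W" using A_W_mult(1)[OF _ n(1)] mult_table by metis
  then have "w3 \<in> span {n}" using span_neg_iff[of w3 "{n}"] by (simp only: W)
  moreover have "w3 \<notin> span {n}"
    by (rule not_in_span_pol[of _ v3]) (simp_all add: pol_table)
  ultimately show False by simp
qed

text \<open>For a basis m, n of \<open>W\<close> write mn = km + ln. Multiplying by m on the left
  and by n on the right, alternativity gives l(mn) = 0 and k(mn) = 0; either mn = 0, or k = l = 0
  and again mn = 0.\<close>

lemma type_b_if_dim_2:
  assumes dim2: "dim W = 2"
  shows "type_b scale (\<cdot>) N A"
proof -
  obtain m n where mn: "m \<in> W" "n \<in> W" "n \<noteq> 0" "m \<notin> span {n}"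
    using exists_independent_pair[of W] dim2 by auto
  have "dim {m, n} = 2" using mn by (simp add: dim_insert)
  then have W: "span {m, n} = W"
    using subspace_dim_equal[of "span {m, n}" W] subspace_W mn dim2 by (simp add: span_minimal)
  then obtain k where "m \<cdot> n - scale k m \<in> span {n}"
    using W_mult[OF mn(1,2)] span_breakdown_eq by blast
  then obtain l where "m \<cdot> n - scale k m = scale l n" by (auto simp: span_singleton)
  then have prod: "m \<cdot> n = scale k m + scale l n" by (simp add: algebra_simps)
  have "m \<cdot> m = 0" "n \<cdot> n = 0" using nilpotent_W mn by (auto simp: nilpotent_def)
  then have "m \<cdot> (m \<cdot> n) = scale l (m \<cdot> n)" "(m \<cdot> n) \<cdot> n = scale k (m \<cdot> n)"
    using arg_cong[OF prod, of "\<lambda>x. m \<cdot> x"] arg_cong[OF prod, of "\<lambda>x. x \<cdot> n"]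
    by (simp_all only: mult_simps scale_zero_right add_0_left add_0_right)
  then have "scale l (m \<cdot> n) = 0" "scale k (m \<cdot> n) = 0"
    using W_mult_mult[OF mn(1,2)] by simp_all
  then have "m \<cdot> n = 0" using prod by auto
  then have "annihilating_nilpotent_pair scale (\<cdot>) m n"
    using mn nilpotent_W by (simp add: annihilating_nilpotent_pair_iff)
  moreover have "A = perp {m, n}" using A_eq W perp_span by metis
  ultimately show ?thesis using type_b_iff by blast
qed

text \<open>If all products in \<open>W\<close> vanished, adjointness would make \<open>W\<close>
  orthogonal to the translates of two independent members m, n. Their sum is the complement of {m,
  n}, so \<open>W\<close> would lie in the span of m and n.\<close>

lemma W_product_nonzero:
  assumes dim3: "dim W = 3"
  shows "\<exists>p\<in>W. \<exists>q\<in>W. p \<cdot> q \<noteq> 0"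
proof (rule ccontr)
  assume "\<not> ?thesis"
  then have zero: "p \<cdot> q = 0" if "p \<in> W" "q \<in> W" for p q using that by blast
  obtain m n where mn: "m \<in> W" "n \<in> W" "n \<noteq> 0" "m \<notin> span {n}"
    using exists_independent_pair[of W] dim3 by auto
  then have pair: "annihilating_nilpotent_pair scale (\<cdot>) m n"
    using zero nilpotent_W by (simp add: annihilating_nilpotent_pair_iff)
  have "W \<subseteq> perp (perp {m, n})"
  proof
    fix p assume p: "p \<in> W"
    have "pol (a \<cdot> x) p = 0" if "a \<in> W" for a x
      using zero[OF that p] nilpotent_norm_tr(3)[OF nilpotent_W[OF that]]
      by (simp add: pol_adjoint_left mult_simps pol_simps)
    then show "p \<in> perp (perp {m, n})"
      using mn(1,2) unfolding perp_annihilating_pair(3)[OF pair]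
      by (auto simp: orthogonal_complement_def set_plus_def left_translates_def pol_simps pol_commute[of p])
  qed
  then have "dim W \<le> dim {m, n}"
    by (simp add: perp_perp dim_mono)
  also have "dim {m, n} = 2" using mn by (simp add: dim_insert)
  finally show False using dim3 by simp
qed

text \<open>The product n = pq annihilates p, q and itself, hence all of \<open>W\<close>, from both
  sides. By adjointness the left and right translates of n are orthogonal to \<open>W\<close>, so
  they lie in \<open>A\<close>; their sum has dimension 5, as has \<open>A\<close>.\<close>

lemma type_a_if_dim_3:
  assumes dim3: "dim W = 3"
  shows "type_a scale (\<cdot>) A"
proof -
  obtain p q where pq: "p \<in> W" "q \<in> W" "p \<cdot> q \<noteq> 0"
    using W_product_nonzero[OF dim3] by blast
  define n where "n = p \<cdot> q"
  have n: "n \<in> W" "n \<noteq> 0" using pq by (simp_all add: n_def W_mult)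
  have pn: "p \<cdot> n = 0" and nq: "n \<cdot> q = 0"
    using W_mult_mult[OF pq(1,2)] by (simp_all add: n_def)
  have np: "n \<cdot> p = 0" using W_anticommute[OF n(1) pq(1)] pn by simp
  have nn: "n \<cdot> n = 0" and qq: "q \<cdot> q = 0" using nilpotent_W n pq by (auto simp: nilpotent_def)
  have "q \<notin> span {n}"
  proof
    assume "q \<in> span {n}"
    then obtain k where "q = scale k n" by (auto simp: span_singleton)
    then have "p \<cdot> q = 0" using pn by (simp add: mult_simps)
    then show False using pq by simp
  qed
  \<comment> \<open>Right multiplication by q kills q and n, but not p.\<close>
  moreover have "p \<notin> span {q, n}"
  proof
    assume "p \<in> span {q, n}"
    then have "p \<cdot> q = 0"
      by (induction p rule: span_induct_alt) (auto simp: mult_simps nq qq)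
    then show False using pq by simp
  qed
  ultimately have "dim {p, q, n} = 3" using n by (simp add: dim_insert)
  then have W: "span {p, q, n} = W"
    using subspace_dim_equal[of "span {p, q, n}" W] subspace_W n pq dim3 by (simp add: span_minimal)
  have nW: "n \<cdot> w = 0" if "w \<in> W" for w
    using that unfolding W[symmetric]
    by (induction w rule: span_induct_alt) (auto simp: mult_simps np nq nn)
  have Wn: "w \<cdot> n = 0" if "w \<in> W" for w
    using W_anticommute[OF that n(1)] nW[OF that] by simp
  have "n \<cdot> x \<in> A" "x \<cdot> n \<in> A" for x
    using nW Wn nilpotent_norm_tr(3)[OF nilpotent_W[OF n(1)]]
    by (auto simp: in_A_iff pol_adjoint_left[of n] pol_adjoint_right[of _ n] mult_simps pol_simps)
  then have subset: "left_translates (\<cdot>) n + right_translates (\<cdot>) n \<subseteq> A"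
    using subspace_add[OF subspace_A]
    by (auto simp: left_translates_def right_translates_def set_plus_def)
  note translates = dim_subalgebra_both_translates[OF nilpotent_W[OF n(1)] n(2)]
  have "left_translates (\<cdot>) n + right_translates (\<cdot>) n = A"
    using subspace_dim_equal[OF _ subspace_A subset] translates dim_W dim3
    by (simp add: subalgebra_def)
  then show ?thesis
    using type_a_iff[of A] nilpotent_W[OF n(1)] n(2) by blast
qed

lemma type_a_or_type_b: "type_a scale (\<cdot>) A \<or> type_b scale (\<cdot>) N A"
proof -
  have "dim W = 2 \<or> dim W = 3"
    using dim_W dim_A dim_W_pos dim_W_not_1 by linarith
  then show ?thesis using type_b_if_dim_2 type_a_if_dim_3 by blast
qed

end

theorem mainTheorem2:
  fixes scale :: "'f::field \<Rightarrow> 'a::ab_group_add \<Rightarrow> 'a"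
    and mult :: "'a \<Rightarrow> 'a \<Rightarrow> 'a"
    and unit :: 'a
    and N :: "'a \<Rightarrow> 'f"
  assumes "octonion_algebra scale mult unit N"
  shows
    "(\<forall>A. subalgebra scale mult A \<and> vector_space.dim scale A > 4 \<longrightarrow>
        A = UNIV \<or> (split_norm N \<and> (type_a scale mult A \<or> type_b scale mult N A))) \<and>
     (\<forall>A m n. subalgebra scale mult A \<and> vector_space.dim scale A = 6 \<and>
        annihilating_nilpotent_pair scale mult m n \<and> A = orthogonal_complement N {m, n} \<longrightarrow>
        A = left_translates mult m + left_translates mult n \<and>
        A = right_translates mult m + right_translates mult n) \<and>
     (split_norm N \<longrightarrow>
        single_orbit scale mult {A. subalgebra scale mult A \<and> type_a scale mult A} \<and>
        single_orbit scale mult {A. subalgebra scale mult A \<and> type_b scale mult N A})"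
proof -
  interpret octonion_algebra scale mult unit N by (rule assms)
  have "split_norm N \<and> (type_a scale mult A \<or> type_b scale mult N A)"
    if "subalgebra scale mult A" "dim A > 4" "A \<noteq> UNIV" for A
  proof -
    interpret large_proper_subalgebra scale mult unit N A
      using that by unfold_locales
    show ?thesis using split type_a_or_type_b by blast
  qed
  then show ?thesis
    using perp_annihilating_pair(3,4) single_orbit_type_a single_orbit_type_b by blast
qed

end
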